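(* Assume that there exists an orthogonal projection $P$ of $\mathcal K$ with $P+\overline P=\mathbf 1$ which commutes with $P_1$ and $G$. Let $p_+=PP_1$, $p_-=PP_2$, and assume that there exists a unitary operator $\mathcal C_{+-}$ from $\mathcal K_-=p_-(\mathcal K)$ onto $\mathcal K_+=p_+(\mathcal K)$ which commutes with $G$. Let $\mathcal C$ be the unique operator on $\mathcal K$ which commutes with $P$, which fulfills $\overline{\mathcal C}=\mathcal C$, and which is given on $P(\mathcal K)=\mathcal K_+\oplus\mathcal K_-$ by the matrix $$P\mathcal CP=\begin{pmatrix}0&\mathcal C_{+-}\\{\mathcal C_{+-}}^*&0\end{pmatrix}.$$ Then $\mathcal C$ is gauge invariant (commutes with $G$), unitary and self-adjoint, it fulfills $\mathcal CC+C\mathcal C=0$ and $\mathcal C^\dagger=-\mathcal C$, and the map $$V\mapsto V^c=\mathcal CV\mathcal C$$ is an involutive automorphism of the semigroup $\mathcal S_{P_1}(\mathcal K,\kappa)^G$. One has $$\mathfrak k_{V^c}=\mathcal C({\mathfrak k_V}^* ),$$ so that the representation $\mathcal U_{V^c}$ of $G$ on $H(\varrho_{V^c})$ is unitarily equivalent to the complex conjugate of $\mathcal U_V$.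
   Context: Let $\mathcal K$ be an infinite-dimensional complex vector space with a nondegenerate hermitian sesquilinear form $\kappa$ (linear in the second argument) and an antilinear involution $f\mapsto f^*$ with $\kappa(f^*,g^* )=-\kappa(g,f)$; $\mathcal H^*=\{f^*:f\in\mathcal H\}$ for subspaces $\mathcal H$. For operators $A$ put $\overline Af=(A(f^* ))^*$. A basis projection of $(\mathcal K,\kappa)$ is a linear operator $Q$ with $Q^2=Q$, $\kappa(f,Qg)=\kappa(Qf,g)$, $Q+\overline Q=\mathbf 1$, and $\kappa(f,Qf)>0$ whenever $Qf\ne0$. Fix a basis projection $P_1$, put $P_2=\mathbf 1-P_1$, $C=P_1-P_2$; $\mathcal K$ is assumed to be (after completion) a separable Hilbert space for the inner product $\langle f,g\rangle_{P_1}=\kappa(f,Cg)$ ("orthogonal", "unitary", "self-adjoint" refer to this inner product). $\mathcal K_n=P_n(\mathcal K)$, $A_{mn}=P_mAP_n$. $A^*$ is the Hilbert space adjoint, $A^\dagger=CA^*C$. On the symmetric Fock space $\mathcal F_s(\mathcal K_1)$ let $\pi_{P_1}(f)=a^*(P_1f)+a(P_1f^* )$ on the dense subspace of algebraic tensors; for $f=f^*\in\mathcal K$, $w(f)$ is the exponential of the closure of $i\pi_{P_1}(f)$, and the Weyl algebra $\mathfrak W(\mathcal K,\kappa)$ is the $C^*$-algebra generated by all $w(f)$. $\mathcal S(\mathcal K,\kappa)=\{V\in\mathfrak B(\mathcal K):\overline V=V,V^\dagger V=\mathbf 1\}$ (Bogoliubov operators); $\varrho_V$ is the $*$-endomorphism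 of $\mathfrak W(\mathcal K,\kappa)$ with $\varrho_V(w(f))=w(Vf)$; $\mathcal S_{P_1}(\mathcal K,\kappa)$ is the set of $V$ with $V_{12}$ Hilbert–Schmidt. $G$ is a group of Bogoliubov operators of index zero commuting with $P_1$ (these are unitary); $\Gamma(U)$ is the usual second quantization of $U_{11}$ on $\mathcal F_s(\mathcal K_1)$. $\mathcal S_{P_1}(\mathcal K,\kappa)^G=\{V\in\mathcal S_{P_1}(\mathcal K,\kappa):[V,U]=0\ \forall U\in G\}$. For $V\in\mathcal S_{P_1}(\mathcal K,\kappa)$ let $E$ be the orthogonal projection onto $\ker V^\dagger$, $A=ECE$ (self-adjoint, boundedly invertible on $\ker V^\dagger$), $A=A_+-A_-$ with $A_\pm\ge0$, $A_+A_-=0$, and $A_+^{-1}$ the inverse of $A_+$ on $\operatorname{ran}A_+$, extended by zero on $(\operatorname{ran}A_+)^\perp$. Set $P_V=VP_1V^\dagger+A_+^{-1}C$ and $\mathfrak k_V=P_V(\ker V^\dagger)$. $H(\varrho_V)=\{\Psi\in\mathfrak B(\mathcal F_s(\mathcal K_1)):\Psi w=\varrho_V(w)\Psi\ \forall w\in\mathfrak W(\mathcal K,\kappa)\}$, a Hilbert space with inner product $\langle\Psi,\Psi'\rangle\mathbf 1=\Psi^*\Psi'$ (it implements $\varrho_V$). For $V\in\mathcal S_{P_1}(\mathcal K,\kappa)^G$, $\mathcal U_V(U)\Psi=\Gamma(U)\Psi\Gamma(U)^*$, $U\in G$, $\Psi\in H(\varrho_V)$. *)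

theory Defs
  imports "HOL-Analysis.Analysis" "HOL-Library.Complex_Order" "HOL-Combinatorics.Permutations"
begin

section \<open>Complex Hilbert spaces\<close>

class complex_vector = real_vector +
  fixes scaleC :: "complex \<Rightarrow> 'a \<Rightarrow> 'a"  (infixr \<open>*\<^sub>C\<close> 75)
  assumes scaleC_add_right: "a *\<^sub>C (x + y) = a *\<^sub>C x + a *\<^sub>C y"
    and scaleC_add_left: "(a + b) *\<^sub>C x = a *\<^sub>C x + b *\<^sub>C x"
    and scaleC_scaleC: "a *\<^sub>C b *\<^sub>C x = (a * b) *\<^sub>C x"
    and scaleC_one: "1 *\<^sub>C x = x"
    and scaleR_scaleC: "r *\<^sub>R x = complex_of_real r *\<^sub>C x"

text \<open>The inner product is linear in its second argument.\<close>

class complex_inner = complex_vector + real_normed_vector +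
  fixes cinner :: "'a \<Rightarrow> 'a \<Rightarrow> complex"
  assumes cinner_commute: "cinner x y = cnj (cinner y x)"
    and cinner_add_right: "cinner x (y + z) = cinner x y + cinner x z"
    and cinner_scaleC_right: "cinner x (c *\<^sub>C y) = c * cinner x y"
    and cinner_self_norm: "cinner x x = complex_of_real ((norm x)\<^sup>2)"

class chilbert_space = complex_inner + complete_space

global_interpretation complex_vector:
  vector_space "scaleC :: complex \<Rightarrow> 'a \<Rightarrow> 'a :: complex_vector"
  by unfold_locales
    (simp_all add: scaleC_add_right scaleC_add_left scaleC_scaleC scaleC_one)

abbreviation cspan :: "'a::complex_vector set \<Rightarrow> 'a set"
  where "cspan \<equiv> complex_vector.span"

abbreviation cdim :: "'a::complex_vector set \<Rightarrow> nat"
  where "cdim \<equiv> complex_vector.dim"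

definition cfinite_dim :: "'a::complex_vector set \<Rightarrow> bool"
  where "cfinite_dim S \<longleftrightarrow> (\<exists>B. finite B \<and> S \<subseteq> cspan B)"

definition clinear :: "('a::complex_vector \<Rightarrow> 'b::complex_vector) \<Rightarrow> bool"
  where "clinear T \<longleftrightarrow> Vector_Spaces.linear scaleC scaleC T"

definition bounded_clinear :: "('a::complex_inner \<Rightarrow> 'b::complex_inner) \<Rightarrow> bool"
  where "bounded_clinear T \<longleftrightarrow> clinear T \<and> bounded_linear T"

text \<open>
  Objects determined by a defining property are introduced with \<open>the_or d P\<close>: the unique \<open>x\<close>
  with \<open>P x\<close>. The value \<open>d\<close> (always a zero element below) is a convention for the case that no
  unique \<open>x\<close> exists, in the same spirit as \<open>x / 0 = 0\<close>.
\<close>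

definition the_or :: "'a \<Rightarrow> ('a \<Rightarrow> bool) \<Rightarrow> 'a"
  where "the_or d P = (if \<exists>!x. P x then THE x. P x else d)"

text \<open>The Hilbert space adjoint, as a map from \<open>H'\<close> to \<open>H\<close>, of an operator \<open>T\<close> from a closed
  subspace \<open>H\<close> to a closed subspace \<open>H'\<close>.\<close>

definition adj_on :: "'a::complex_inner set \<Rightarrow> ('a \<Rightarrow> 'b::complex_inner) \<Rightarrow> 'b \<Rightarrow> 'a"
  where "adj_on H T y = the_or 0 (\<lambda>x. x \<in> H \<and> (\<forall>z\<in>H. cinner x z = cinner y (T z)))"

abbreviation adj :: "('a::complex_inner \<Rightarrow> 'b::complex_inner) \<Rightarrow> 'b \<Rightarrow> 'a"
  where "adj \<equiv> adj_on UNIV"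

definition self_adjoint :: "('a::complex_inner \<Rightarrow> 'a) \<Rightarrow> bool"
  where "self_adjoint T \<longleftrightarrow> bounded_clinear T \<and> adj T = T"

definition positive_op :: "('a::complex_inner \<Rightarrow> 'a) \<Rightarrow> bool"
  where "positive_op T \<longleftrightarrow> bounded_clinear T \<and> (\<forall>x. 0 \<le> cinner x (T x))"

definition orth_projection :: "('a::complex_inner \<Rightarrow> 'a) \<Rightarrow> bool"
  where "orth_projection Q \<longleftrightarrow> self_adjoint Q \<and> Q \<circ> Q = Q"

definition proj_onto :: "'a::complex_inner set \<Rightarrow> 'a \<Rightarrow> 'a"
  where "proj_onto S = the_or (\<lambda>_. 0) (\<lambda>Q. orth_projection Q \<and> range Q = S)"

definition unitary_between ::
  "'a::complex_inner set \<Rightarrow> 'b::complex_inner set \<Rightarrow> ('a \<Rightarrow> 'b) \<Rightarrow> bool"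
  where "unitary_between H H' T \<longleftrightarrow>
    bij_betw T H H' \<and>
    (\<forall>x\<in>H. \<forall>y\<in>H. T (x + y) = T x + T y) \<and>
    (\<forall>x\<in>H. \<forall>c. T (c *\<^sub>C x) = c *\<^sub>C T x) \<and>
    (\<forall>x\<in>H. \<forall>y\<in>H. cinner (T x) (T y) = cinner x y)"

abbreviation unitary :: "('a::complex_inner \<Rightarrow> 'b::complex_inner) \<Rightarrow> bool"
  where "unitary \<equiv> unitary_between UNIV UNIV"

definition orthonormal_basis :: "'a::complex_inner set \<Rightarrow> bool"
  where "orthonormal_basis B \<longleftrightarrow>
    (\<forall>e\<in>B. \<forall>e'\<in>B. cinner e e' = (if e = e' then 1 else 0)) \<and> closure (cspan B) = UNIV"

definition hilbert_schmidt :: "('a::complex_inner \<Rightarrow> 'b::complex_inner) \<Rightarrow> bool"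
  where "hilbert_schmidt T \<longleftrightarrow> bounded_clinear T \<and>
    (\<exists>B. orthonormal_basis B \<and> (\<lambda>e. (norm (T e))\<^sup>2) summable_on B)"

definition op_kernel :: "('a \<Rightarrow> 'b::zero) \<Rightarrow> 'a set"
  where "op_kernel T = {x. T x = 0}"

definition has_index :: "('a::complex_inner \<Rightarrow> 'b::complex_inner) \<Rightarrow> int \<Rightarrow> bool"
  where "has_index T n \<longleftrightarrow> cfinite_dim (op_kernel T) \<and> cfinite_dim (op_kernel (adj T)) \<and>
    n = int (cdim (op_kernel T)) - int (cdim (op_kernel (adj T)))"

text \<open>\<open>pos_part A\<close> is \<open>A\<^sub>+\<close> in the decomposition \<open>A = A\<^sub>+ - A\<^sub>-\<close>.\<close>

definition pos_part :: "('a::complex_inner \<Rightarrow> 'a) \<Rightarrow> 'a \<Rightarrow> 'a"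
  where "pos_part A = the_or (\<lambda>_. 0) (\<lambda>Ap. \<exists>Am. positive_op Ap \<and> positive_op Am \<and>
    (\<forall>x. A x = Ap x - Am x) \<and> (\<forall>x. Ap (Am x) = 0))"

text \<open>The inverse of \<open>T\<close> on \<open>range T\<close>, extended by zero on the orthogonal complement: for
  \<open>y = T x + z\<close> with \<open>x \<in> range T\<close> and \<open>z \<bottom> range T\<close>, the value at \<open>y\<close> is \<open>x\<close>.\<close>

definition inverse_on_range :: "('a::complex_inner \<Rightarrow> 'a) \<Rightarrow> 'a \<Rightarrow> 'a"
  where "inverse_on_range T y = the_or 0 (\<lambda>x. x \<in> range T \<and>
    (\<exists>z. (\<forall>u. cinner (T u) z = 0) \<and> y = T x + z))"

text \<open>The linear map on the span of \<open>e ` I\<close> that sends \<open>e i\<close> to \<open>t i\<close>; zero off the span.\<close>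

definition lin_ext_on ::
  "'i set \<Rightarrow> ('i \<Rightarrow> 'a::complex_vector) \<Rightarrow> ('i \<Rightarrow> 'b::complex_vector) \<Rightarrow> 'a \<Rightarrow> 'b"
  where "lin_ext_on I e t x = the_or 0 (\<lambda>y. \<exists>S c. finite S \<and> S \<subseteq> I \<and>
    x = (\<Sum>i\<in>S. c i *\<^sub>C e i) \<and> y = (\<Sum>i\<in>S. c i *\<^sub>C t i))"


section \<open>Exponentials of unbounded operators\<close>

text \<open>Unbounded operators are given by their graphs. The exponential of a closed skew-adjoint \<open>T\<close>
  is the value at time 1 of the strongly continuous unitary group \<open>exp (t T)\<close> generated by \<open>T\<close>
  (Stone's theorem).\<close>

definition unitary_group :: "(real \<Rightarrow> 'a::complex_inner \<Rightarrow> 'a) \<Rightarrow> bool"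
  where "unitary_group U \<longleftrightarrow> (\<forall>t. unitary (U t)) \<and> (\<forall>s t. U (s + t) = U s \<circ> U t) \<and>
    (\<forall>x. continuous_on UNIV (\<lambda>t. U t x))"

definition generator_graph :: "(real \<Rightarrow> 'a::complex_inner \<Rightarrow> 'a) \<Rightarrow> ('a \<times> 'a) set"
  where "generator_graph U = {(x, y). ((\<lambda>t. (U t x - x) /\<^sub>R t) \<longlongrightarrow> y) (at 0)}"

definition op_exp :: "('a::complex_inner \<times> 'a) set \<Rightarrow> 'a \<Rightarrow> 'a"
  where "op_exp T = the_or (\<lambda>_. 0)
    (\<lambda>W. \<exists>U. unitary_group U \<and> generator_graph U = T \<and> W = U 1)"


section \<open>Concrete C*-algebras\<close>

definition cstar_subalgebra :: "('a::complex_inner \<Rightarrow> 'a) set \<Rightarrow> bool"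
  where "cstar_subalgebra A \<longleftrightarrow> A \<noteq> {} \<and>
    (\<forall>a\<in>A. bounded_clinear a) \<and>
    (\<forall>a\<in>A. \<forall>b\<in>A. (\<lambda>x. a x + b x) \<in> A) \<and>
    (\<forall>a\<in>A. \<forall>c. (\<lambda>x. c *\<^sub>C a x) \<in> A) \<and>
    (\<forall>a\<in>A. \<forall>b\<in>A. a \<circ> b \<in> A) \<and>
    (\<forall>a\<in>A. adj a \<in> A) \<and>
    (\<forall>s a. (\<forall>n::nat. s n \<in> A) \<and> bounded_clinear a \<and>
       (\<lambda>n. onorm (\<lambda>x. s n x - a x)) \<longlonglongrightarrow> 0 \<longrightarrow> a \<in> A)"

definition cstar_generated :: "('a::complex_inner \<Rightarrow> 'a) set \<Rightarrow> ('a \<Rightarrow> 'a) set"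
  where "cstar_generated S = \<Inter>{A. cstar_subalgebra A \<and> S \<subseteq> A}"

definition star_endomorphism ::
  "('a::complex_inner \<Rightarrow> 'a) set \<Rightarrow> (('a \<Rightarrow> 'a) \<Rightarrow> ('a \<Rightarrow> 'a)) \<Rightarrow> bool"
  where "star_endomorphism A \<rho> \<longleftrightarrow>
    (\<forall>a\<in>A. \<rho> a \<in> A) \<and>
    (\<forall>a\<in>A. \<forall>b\<in>A. \<rho> (\<lambda>x. a x + b x) = (\<lambda>x. \<rho> a x + \<rho> b x)) \<and>
    (\<forall>a\<in>A. \<forall>c. \<rho> (\<lambda>x. c *\<^sub>C a x) = (\<lambda>x. c *\<^sub>C \<rho> a x)) \<and>
    (\<forall>a\<in>A. \<forall>b\<in>A. \<rho> (a \<circ> b) = \<rho> a \<circ> \<rho> b) \<and>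
    (\<forall>a\<in>A. \<rho> (adj a) = adj (\<rho> a))"


section \<open>Unitary equivalence and complex conjugation of representations\<close>

text \<open>Spaces of operators carry a Hilbert space structure different from that of a type class, so
  their structure is recorded explicitly.\<close>

record 'h inner_space =
  carr :: "'h set"
  add :: "'h \<Rightarrow> 'h \<Rightarrow> 'h"
  scale :: "complex \<Rightarrow> 'h \<Rightarrow> 'h"
  ip :: "'h \<Rightarrow> 'h \<Rightarrow> complex"

definition conjugate_space :: "'h inner_space \<Rightarrow> 'h inner_space"
  where "conjugate_space H =
    H\<lparr>scale := \<lambda>c. scale H (cnj c), ip := \<lambda>x y. cnj (ip H x y)\<rparr>"

text \<open>A representation of \<open>G\<close> is a pair of a space and a map \<open>\<pi>\<close> on \<open>G\<close>. The complex conjugate of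
  \<open>(H, \<pi>)\<close> is \<open>(conjugate_space H, \<pi>)\<close>: the same operators on the conjugate space.\<close>

definition unitarily_equivalent ::
  "'g set \<Rightarrow> 'h inner_space \<times> ('g \<Rightarrow> 'h \<Rightarrow> 'h) \<Rightarrow> 'i inner_space \<times> ('g \<Rightarrow> 'i \<Rightarrow> 'i) \<Rightarrow> bool"
  where "unitarily_equivalent G R R' \<longleftrightarrow>
    (let (H, \<pi>) = R; (H', \<pi>') = R' in
     \<exists>T. bij_betw T (carr H) (carr H') \<and>
       (\<forall>x\<in>carr H. \<forall>y\<in>carr H. T (add H x y) = add H' (T x) (T y)) \<and>
       (\<forall>x\<in>carr H. \<forall>c. T (scale H c x) = scale H' c (T x)) \<and>
       (\<forall>x\<in>carr H. \<forall>y\<in>carr H. ip H' (T x) (T y) = ip H x y) \<and>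
       (\<forall>g\<in>G. \<forall>x\<in>carr H. T (\<pi> g x) = \<pi>' g (T x)))"

definition complex_conjugate_rep ::
  "'h inner_space \<times> ('g \<Rightarrow> 'h \<Rightarrow> 'h) \<Rightarrow> 'h inner_space \<times> ('g \<Rightarrow> 'h \<Rightarrow> 'h)"
  where "complex_conjugate_rep R = (conjugate_space (fst R), snd R)"

definition semigroup_automorphism :: "('a \<Rightarrow> 'a) set \<Rightarrow> (('a \<Rightarrow> 'a) \<Rightarrow> ('a \<Rightarrow> 'a)) \<Rightarrow> bool"
  where "semigroup_automorphism S \<phi> \<longleftrightarrow>
    bij_betw \<phi> S S \<and> (\<forall>V\<in>S. \<forall>W\<in>S. \<phi> (V \<circ> W) = \<phi> V \<circ> \<phi> W)"


section \<open>Selfdual CCR spaces and Bogoliubov operators\<close>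

definition conj_op :: "('k \<Rightarrow> 'k) \<Rightarrow> ('k \<Rightarrow> 'k) \<Rightarrow> 'k \<Rightarrow> 'k"
  where "conj_op star A f = star (A (star f))"

text \<open>On \<^typ>\<open>complex\<close>, \<open>0 < z\<close> means that \<open>z\<close> is real and positive.\<close>

definition basis_projection ::
  "('k::complex_vector \<Rightarrow> 'k \<Rightarrow> complex) \<Rightarrow> ('k \<Rightarrow> 'k) \<Rightarrow> ('k \<Rightarrow> 'k) \<Rightarrow> bool"
  where "basis_projection \<kappa> star Q \<longleftrightarrow>
    clinear Q \<and> Q \<circ> Q = Q \<and>
    (\<forall>f g. \<kappa> f (Q g) = \<kappa> (Q f) g) \<and>
    (\<forall>f. Q f + conj_op star Q f = f) \<and>
    (\<forall>f. Q f \<noteq> 0 \<longrightarrow> 0 < \<kappa> f (Q f))"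

text \<open>The Hilbert space structure of the type \<open>'k\<close> is tied to \<open>\<kappa>\<close> and \<open>P\<^sub>1\<close> by the last
  assumption \<open>\<langle>f, g\<rangle> = \<kappa> f (C g)\<close> with \<open>C = P\<^sub>1 - P\<^sub>2 = P\<^sub>1 - (1 - P\<^sub>1)\<close>; completeness is part of
  the type class.\<close>

locale ccr_space =
  fixes \<kappa> :: "'k::chilbert_space \<Rightarrow> 'k \<Rightarrow> complex"
    and star :: "'k \<Rightarrow> 'k"
    and P1 :: "'k \<Rightarrow> 'k"
  assumes infinite_dim: "\<not> cfinite_dim (UNIV :: 'k set)"
    and separable: "\<exists>S :: 'k set. countable S \<and> closure S = UNIV"
    and form_add_right: "\<kappa> f (g + h) = \<kappa> f g + \<kappa> f h"
    and form_scaleC_right: "\<kappa> f (c *\<^sub>C g) = c * \<kappa> f g"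
    and form_hermitian: "\<kappa> f g = cnj (\<kappa> g f)"
    and form_nondegenerate: "(\<forall>g. \<kappa> f g = 0) \<Longrightarrow> f = 0"
    and star_add: "star (f + g) = star f + star g"
    and star_scaleC: "star (c *\<^sub>C f) = cnj c *\<^sub>C star f"
    and star_star: "star (star f) = f"
    and form_star: "\<kappa> (star f) (star g) = - \<kappa> g f"
    and P1_basis_projection: "basis_projection \<kappa> star P1"
    and cinner_form: "cinner f g = \<kappa> f (P1 g - (g - P1 g))"
begin

definition P2 :: "'k \<Rightarrow> 'k"
  where "P2 f = f - P1 f"

definition C :: "'k \<Rightarrow> 'k"
  where "C f = P1 f - P2 f"

definition dagger :: "('k \<Rightarrow> 'k) \<Rightarrow> 'k \<Rightarrow> 'k"
  where "dagger A = C \<circ> adj A \<circ> C"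

definition bogoliubov :: "('k \<Rightarrow> 'k) set"
  where "bogoliubov = {V. bounded_clinear V \<and> conj_op star V = V \<and> dagger V \<circ> V = id}"

definition bogoliubov_P1 :: "('k \<Rightarrow> 'k) set"
  where "bogoliubov_P1 = {V \<in> bogoliubov. hilbert_schmidt (P1 \<circ> V \<circ> P2)}"

definition gauge_group :: "('k \<Rightarrow> 'k) set \<Rightarrow> bool"
  where "gauge_group G \<longleftrightarrow>
    G \<subseteq> {U \<in> bogoliubov. has_index U 0 \<and> U \<circ> P1 = P1 \<circ> U} \<and>
    id \<in> G \<and> (\<forall>U\<in>G. \<forall>W\<in>G. U \<circ> W \<in> G) \<and>
    (\<forall>U\<in>G. \<exists>W\<in>G. U \<circ> W = id \<and> W \<circ> U = id)"

definition bogoliubov_P1_G :: "('k \<Rightarrow> 'k) set \<Rightarrow> ('k \<Rightarrow> 'k) set"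
  where "bogoliubov_P1_G G = {V \<in> bogoliubov_P1. \<forall>U\<in>G. V \<circ> U = U \<circ> V}"

definition A_plus :: "('k \<Rightarrow> 'k) \<Rightarrow> 'k \<Rightarrow> 'k"
  where "A_plus V = (let E = proj_onto (op_kernel (dagger V)) in pos_part (E \<circ> C \<circ> E))"

definition P_V :: "('k \<Rightarrow> 'k) \<Rightarrow> 'k \<Rightarrow> 'k"
  where "P_V V f = V (P1 (dagger V f)) + inverse_on_range (A_plus V) (C f)"

definition frak_k :: "('k \<Rightarrow> 'k) \<Rightarrow> 'k set"
  where "frak_k V = P_V V ` op_kernel (dagger V)"

text \<open>\<open>charge_conjugation P Cpm Cc\<close>: \<open>Cc\<close> is an operator with the defining properties of
  \<open>\<C>\<close>, where \<open>Cpm\<close> is the given unitary from \<open>K\<^sub>- = range (P \<circ> P2)\<close> onto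
  \<open>K\<^sub>+ = range (P \<circ> P1)\<close>; the last conjunct is the matrix of \<open>P \<C> P\<close>.\<close>

definition charge_conjugation :: "('k \<Rightarrow> 'k) \<Rightarrow> ('k \<Rightarrow> 'k) \<Rightarrow> ('k \<Rightarrow> 'k) \<Rightarrow> bool"
  where "charge_conjugation P Cpm Cc \<longleftrightarrow>
    clinear Cc \<and> Cc \<circ> P = P \<circ> Cc \<and> conj_op star Cc = Cc \<and>
    (\<forall>f. P (Cc (P f)) = Cpm (P (P2 f)) + adj_on (range (P \<circ> P2)) Cpm (P (P1 f)))"

end


section \<open>Fock space, Weyl algebra and implementers\<close>

text \<open>
  \<open>'f\<close> together with \<open>tens\<close> is a symmetric Fock space over \<open>K\<^sub>1 = range P1\<close>, that is, the Hilbert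
  space direct sum of the symmetric tensor powers of \<open>K\<^sub>1\<close>, determined by the two assumptions up
  to a unique unitary. For \<open>f\<^sub>1, ..., f\<^sub>n \<in> K\<^sub>1\<close>, \<open>tens [f\<^sub>1, ..., f\<^sub>n]\<close> is the symmetric tensor
  \<open>a\<^sup>*(f\<^sub>1) ... a\<^sup>*(f\<^sub>n) \<Omega>\<close>, i.e. \<open>\<surd>n!\<close> times the projection of \<open>f\<^sub>1 \<otimes> ... \<otimes> f\<^sub>n\<close> onto
  the symmetric tensors, and \<open>tens [] = \<Omega>\<close> is the vacuum. Multilinearity and symmetry of \<open>tens\<close>
  follow from the formula for the inner products. Values of \<open>tens\<close> on other lists are irrelevant.
\<close>

locale fock_space = ccr_space \<kappa> star P1
  for \<kappa> :: "'k::chilbert_space \<Rightarrow> 'k \<Rightarrow> complex" and star P1 :: "'k \<Rightarrow> 'k" +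
  fixes tens :: "'k list \<Rightarrow> 'f::chilbert_space"
  assumes cinner_tens: "\<lbrakk>fs \<in> lists (range P1); gs \<in> lists (range P1)\<rbrakk> \<Longrightarrow>
      cinner (tens fs) (tens gs) =
        (if length fs = length gs
         then \<Sum>\<sigma> | \<sigma> permutes {..<length fs}. \<Prod>i<length fs. cinner (fs ! i) (gs ! \<sigma> i)
         else 0)"
    and tens_total: "closure (cspan (tens ` lists (range P1))) = UNIV"
begin

definition algebraic_tensors :: "'f set"
  where "algebraic_tensors = cspan (tens ` lists (range P1))"

definition creation :: "'k \<Rightarrow> 'f \<Rightarrow> 'f"
  where "creation f = lin_ext_on (lists (range P1)) tens (\<lambda>fs. tens (f # fs))"

definition annihilation :: "'k \<Rightarrow> 'f \<Rightarrow> 'f"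
  where "annihilation f = lin_ext_on (lists (range P1)) tens
    (\<lambda>fs. \<Sum>i<length fs. cinner f (fs ! i) *\<^sub>C tens (take i fs @ drop (Suc i) fs))"

definition field_op :: "'k \<Rightarrow> 'f \<Rightarrow> 'f"
  where "field_op f \<psi> = creation (P1 f) \<psi> + annihilation (P1 (star f)) \<psi>"

definition weyl :: "'k \<Rightarrow> 'f \<Rightarrow> 'f"
  where "weyl f = op_exp (closure ((\<lambda>\<psi>. (\<psi>, \<i> *\<^sub>C field_op f \<psi>)) ` algebraic_tensors))"

definition weyl_algebra :: "('f \<Rightarrow> 'f) set"
  where "weyl_algebra = cstar_generated (weyl ` {f. star f = f})"

text \<open>As an endomorphism of the Weyl algebra only its values there matter; they are set to zero
  elsewhere to have a unique function.\<close>

definition bogoliubov_endo :: "('k \<Rightarrow> 'k) \<Rightarrow> ('f \<Rightarrow> 'f) \<Rightarrow> ('f \<Rightarrow> 'f)"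
  where "bogoliubov_endo V = the_or (\<lambda>_ _. 0) (\<lambda>\<rho>. star_endomorphism weyl_algebra \<rho> \<and>
    (\<forall>f. star f = f \<longrightarrow> \<rho> (weyl f) = weyl (V f)) \<and>
    (\<forall>a. a \<notin> weyl_algebra \<longrightarrow> \<rho> a = (\<lambda>_. 0)))"

definition implementers :: "(('f \<Rightarrow> 'f) \<Rightarrow> ('f \<Rightarrow> 'f)) \<Rightarrow> ('f \<Rightarrow> 'f) inner_space"
  where "implementers \<rho> =
    \<lparr>carr = {\<Psi>. bounded_clinear \<Psi> \<and> (\<forall>w\<in>weyl_algebra. \<Psi> \<circ> w = \<rho> w \<circ> \<Psi>)},
     add = \<lambda>\<Psi> \<Phi> x. \<Psi> x + \<Phi> x,
     scale = \<lambda>c \<Psi> x. c *\<^sub>C \<Psi> x,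
     ip = \<lambda>\<Psi> \<Phi>. the_or 0 (\<lambda>c. \<forall>x. adj \<Psi> (\<Phi> x) = c *\<^sub>C x)\<rparr>"

definition second_quantization :: "('k \<Rightarrow> 'k) \<Rightarrow> 'f \<Rightarrow> 'f"
  where "second_quantization U = the_or (\<lambda>_. 0) (\<lambda>T. bounded_clinear T \<and>
    (\<forall>fs\<in>lists (range P1). T (tens fs) = tens (map (\<lambda>f. P1 (U f)) fs)))"

text \<open>The space \<open>H(\<rho>\<^sub>V)\<close> with the representation \<open>\<U>\<^sub>V\<close>.\<close>

definition gauge_rep ::
  "('k \<Rightarrow> 'k) \<Rightarrow> ('f \<Rightarrow> 'f) inner_space \<times> (('k \<Rightarrow> 'k) \<Rightarrow> ('f \<Rightarrow> 'f) \<Rightarrow> ('f \<Rightarrow> 'f))"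
  where "gauge_rep V = (implementers (bogoliubov_endo V),
    \<lambda>U \<Psi>. second_quantization U \<circ> \<Psi> \<circ> adj (second_quantization U))"

end

end

theory Submission
  imports Defs
begin

text \<open>
  Write \<open>J = Cc \<circ> star\<close>. Both factors exchange \<open>range P1\<close> and \<open>range P2\<close>, and \<open>star\<close> is
  antiunitary, so \<open>J\<close> is an antiunitary involution which commutes with \<open>P1\<close>, \<open>C\<close>, \<open>star\<close> and
  the gauge group. Since a Bogoliubov operator \<open>V\<close> commutes with \<open>star\<close>, its charge conjugate
  is \<open>Cc \<circ> V \<circ> Cc = J \<circ> V \<circ> J\<close>. Hence everything which is built from \<open>V\<close> by means of the
  Hilbert space structure, \<open>C\<close>, \<open>P1\<close> and \<open>star\<close> is carried by \<open>J\<close> to the corresponding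
  object for \<open>V\<^sup>c\<close>: the adjoint, the kernel of the dagger, the positive part of \<open>E C E\<close>, its
  inverse, \<open>P_V\<close>, and therefore \<open>frak_k\<close>.

  The same argument one level up gives the statement on representations. As \<open>J\<close> restricts to
  \<open>range P1\<close>, it has a second quantization \<open>\<Theta>\<close> on Fock space, an antiunitary involution
  sending \<open>f\<^sub>1 \<otimes> ... \<otimes> f\<^sub>n\<close> to \<open>J f\<^sub>1 \<otimes> ... \<otimes> J f\<^sub>n\<close>. It maps the field operator of
  \<open>f\<close> to that of \<open>J f\<close>, so, being antilinear, it maps the Weyl operator of \<open>f\<close> to that of
  \<open>- J f\<close>. It follows that \<open>a \<mapsto> \<Theta> a \<Theta>\<close> preserves the Weyl algebra and carries the
  endomorphism of \<open>V\<close> to that of \<open>V\<^sup>c\<close>. So \<open>\<Psi> \<mapsto> \<Theta> \<Psi> \<Theta>\<close> is an antiunitary map between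
  the spaces of implementers, and it intertwines the two representations because
  \<open>\<Theta>\<close> commutes with the second quantization of a gauge transformation.

  Throughout, the objects are described by defining properties. Such a description is
  transported by an involution as a whole (\<open>the_or_involution\<close>), including the default value in
  the degenerate case, so it suffices to see that each property is preserved. The remaining part
  is the algebra of \<open>Cc\<close>, which is determined on \<open>range P\<close> by its matrix and on the
  complement by reality.
\<close>

section \<open>Elementary facts on complex inner products\<close>

lemma clinear_iff:
  "clinear T \<longleftrightarrow> (\<forall>x y. T (x + y) = T x + T y) \<and> (\<forall>c x. T (c *\<^sub>C x) = c *\<^sub>C T x)"
  unfolding clinear_def Vector_Spaces.linear_def module_hom_def module_hom_axioms_def
  by (auto intro: complex_vector.vector_space_axioms complex_vector.module_axioms)

lemma scaleC_minus_one: "(- 1) *\<^sub>C x = - (x :: 'a::complex_vector)"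
  by (simp add: scaleC_one)

lemma cinner_add_left: "cinner (x + y) z = cinner x z + cinner y z"
  by (metis cinner_commute cinner_add_right complex_cnj_add)

lemma cinner_scaleC_left: "cinner (c *\<^sub>C x) z = cnj c * cinner x z"
  by (metis cinner_commute cinner_scaleC_right complex_cnj_mult)

lemma cinner_minus_right: "cinner x (- y) = - cinner x y"
  using cinner_scaleC_right[of x "- 1" y] by (simp add: scaleC_minus_one)

lemma cinner_minus_left: "cinner (- x) y = - cinner x y"
  by (metis cinner_commute cinner_minus_right complex_cnj_minus)

lemma cinner_diff_right: "cinner x (y - z) = cinner x y - cinner x z"
  using cinner_add_right[of x y "- z"] by (simp add: cinner_minus_right)

lemma cinner_diff_left: "cinner (x - y) z = cinner x z - cinner y z"
  using cinner_add_left[of x "- y" z] by (simp add: cinner_minus_left)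

lemma cinner_zero_left: "cinner 0 y = 0"
  using cinner_diff_left[of 0 0 y] by simp

lemma cinner_self_eq_0: "cinner x x = 0 \<longleftrightarrow> x = 0"
  by (simp add: cinner_self_norm)

lemma norm_eq_if_cinner_self_eq: "cinner x x = cinner y y \<Longrightarrow> norm x = norm y"
  by (simp add: cinner_self_norm del: of_real_power)

lemma cinner_eqI:
  assumes "\<And>z. cinner x z = cinner y z"
  shows "x = y"
  using assms[of "x - y"] cinner_diff_left[of x y "x - y"] cinner_self_eq_0[of "x - y"] by simp

lemma Re_cinner_polarization:
  "4 * Re (cinner x y) = (norm (x + y))\<^sup>2 - (norm (x - y))\<^sup>2"
proof -
  have "complex_of_real ((norm (x + y))\<^sup>2) - complex_of_real ((norm (x - y))\<^sup>2)
      = 2 * (cinner x y + cnj (cinner x y))"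
    unfolding cinner_self_norm[symmetric]
    by (simp add: cinner_add_left cinner_add_right cinner_diff_left cinner_diff_right
        cinner_commute[of y x])
  then show ?thesis
    by (simp add: complex_eq_iff)
qed

text \<open>The inner product is determined by the norm, so norm preservation is the only metric
  property that has to be carried through a completion.\<close>

lemma antilinear_isometry_cinner:
  fixes J :: "'a::complex_inner \<Rightarrow> 'a"
  assumes add: "\<And>x y. J (x + y) = J x + J y"
    and scale: "\<And>c x. J (c *\<^sub>C x) = cnj c *\<^sub>C J x"
    and norm: "\<And>x. norm (J x) = norm x"
  shows "cinner (J x) (J y) = cnj (cinner x y)"
proof -
  have minus: "J (- x) = - J x" for x
    using scale[of "- 1" x] by (simp add: scaleC_minus_one)
  have Re: "Re (cinner (J x) (J y)) = Re (cinner x y)" for x y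
    using Re_cinner_polarization[of "J x" "J y"] Re_cinner_polarization[of x y]
      norm[of "x + y"] norm[of "x - y"] add[of x y] add[of x "- y"] minus[of y] by simp
  have "Im (cinner (J x) (J y)) = - Im (cinner x y)"
    using Re[of x "\<i> *\<^sub>C y"] scale[of \<i> y]
    by (simp add: cinner_scaleC_right cinner_minus_right)
  with Re[of x y] show ?thesis
    by (simp add: complex_eq_iff)
qed

section \<open>Objects carried along by an involution\<close>

text \<open>The involution matches the solutions of the two descriptions, so they have a unique solution
  at the same time; if they do not, both sides are the default value.\<close>

lemma the_or_involution:
  assumes inv: "\<And>x. \<phi> (\<phi> x) = x" and default: "\<phi> d = d"
    and PQ: "\<And>x. P x \<Longrightarrow> Q (\<phi> x)" and QP: "\<And>x. Q x \<Longrightarrow> P (\<phi> x)"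
  shows "the_or d Q = \<phi> (the_or d P)"
proof (cases "\<exists>!x. P x")
  case True
  then obtain x where x: "P x" "\<And>y. P y \<Longrightarrow> y = x" by blast
  then have y: "Q (\<phi> x)" "\<And>y. Q y \<Longrightarrow> y = \<phi> x"
    using PQ QP inv by metis+
  have "(THE x. P x) = x" "(THE x. Q x) = \<phi> x"
    by (rule the_equality, fact, fact)+
  moreover have "\<exists>!x. Q x" using y by blast
  ultimately show ?thesis using True by (simp add: the_or_def)
next
  case False
  then have "\<not> (\<exists>!x. Q x)" using PQ QP inv by metis
  with False default show ?thesis by (simp add: the_or_def)
qed

text \<open>One inclusion suffices: applied to \<open>\<phi> ` S\<close> it yields the reverse one.\<close>

lemma involution_image_commute:
  assumes inv: "\<And>x. \<phi> (\<phi> x) = x" and sub: "\<And>S. \<phi> ` F S \<subseteq> F (\<phi> ` S)"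
  shows "F (\<phi> ` S) = \<phi> ` F S"
proof
  have invol: "\<phi> ` \<phi> ` S = S" for S by (simp add: image_image inv)
  have "\<phi> ` \<phi> ` F (\<phi> ` S) \<subseteq> \<phi> ` F S"
    using image_mono[OF sub[of "\<phi> ` S"], of \<phi>] by (simp only: invol)
  then show "F (\<phi> ` S) \<subseteq> \<phi> ` F S" by (simp only: invol)
qed (rule sub)

lemma the_or_equality:
  assumes "P x" "\<And>y. P y \<Longrightarrow> y = x"
  shows "the_or d P = x"
  using assms unfolding the_or_def by (metis the_equality)


section \<open>Conjugations of a Hilbert space\<close>

text \<open>An antiunitary involution \<open>J\<close> acts on operators by \<open>conj_op J\<close>, an antilinear
  multiplicative involution. The lemmas below say that all notions derived from the Hilbert space
  structure are invariant under this action.\<close>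

locale conjugation =
  fixes J :: "'a::complex_inner \<Rightarrow> 'a"
  assumes J_add: "J (x + y) = J x + J y"
    and J_scaleC: "J (c *\<^sub>C x) = cnj c *\<^sub>C J x"
    and J_J: "J (J x) = x"
    and J_cinner: "cinner (J x) (J y) = cnj (cinner x y)"
begin

lemma J_minus: "J (- x) = - J x"
  using J_scaleC[of "- 1" x] by (simp add: scaleC_minus_one)

lemma J_zero: "J 0 = 0"
  using J_add[of 0 0] by simp

lemma J_diff: "J (x - y) = J x - J y"
  using J_add[of x "- y"] by (simp add: J_minus)

lemma J_scaleR: "J (r *\<^sub>R x) = r *\<^sub>R J x"
  by (simp add: scaleR_scaleC J_scaleC)

lemma J_sum: "J (\<Sum>i\<in>S. f i) = (\<Sum>i\<in>S. J (f i))"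
  by (induction S rule: infinite_finite_induct) (simp_all add: J_zero J_add)

lemma J_norm: "norm (J x) = norm x"
  by (rule norm_eq_if_cinner_self_eq) (metis J_cinner cinner_commute)

lemma J_bounded_linear: "bounded_linear J"
  by (rule bounded_linear_intro[where K = 1]) (simp_all add: J_add J_scaleR J_norm)

lemma bij_J: "bij J"
  using J_J by (metis bij_betw_def injI surjI)

lemma range_comp_J: "range (\<lambda>x. f (J x)) = range f"
proof -
  have "f ` range J = range f" using bij_J by (simp only: bij_def)
  then show ?thesis by (simp only: image_image)
qed

lemma cinner_J_left: "cinner (J x) y = cnj (cinner x (J y))"
  by (metis J_cinner J_J)

lemma cinner_J_right: "cinner x (J y) = cnj (cinner (J x) y)"
  by (metis J_cinner J_J)

lemma J_image_iff: "x \<in> J ` S \<longleftrightarrow> J x \<in> S"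
  by (metis J_J image_iff)

lemma conj_op_conj_op: "conj_op J (conj_op J A) = A"
  by (rule ext) (simp add: conj_op_def J_J)

lemma conj_op_comp: "conj_op J (A \<circ> B) = conj_op J A \<circ> conj_op J B"
  by (rule ext) (simp add: conj_op_def J_J)

lemma conj_op_add: "conj_op J (\<lambda>x. a x + b x) = (\<lambda>x. conj_op J a x + conj_op J b x)"
  by (rule ext) (simp add: conj_op_def J_add)

lemma conj_op_diff: "conj_op J (\<lambda>x. a x - b x) = (\<lambda>x. conj_op J a x - conj_op J b x)"
  by (rule ext) (simp add: conj_op_def J_diff)

lemma conj_op_scaleC: "conj_op J (\<lambda>x. c *\<^sub>C a x) = (\<lambda>x. cnj c *\<^sub>C conj_op J a x)"
  by (rule ext) (simp add: conj_op_def J_scaleC)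

lemma conj_op_zero: "conj_op J (\<lambda>_. 0) = (\<lambda>_. 0)"
  by (rule ext) (simp add: conj_op_def J_zero)

lemma conj_op_image_iff: "a \<in> conj_op J ` A \<longleftrightarrow> conj_op J a \<in> A"
  by (metis conj_op_conj_op image_iff)

lemma conj_op_fixed_iff: "conj_op J A = A \<longleftrightarrow> (\<forall>x. J (A x) = A (J x))"
proof
  assume "conj_op J A = A"
  from fun_cong[OF this, of "J x" for x] show "\<forall>x. J (A x) = A (J x)"
    by (simp add: conj_op_def J_J)
qed (auto simp: conj_op_def J_J)

lemma bounded_clinear_conj_op:
  assumes "bounded_clinear A"
  shows "bounded_clinear (conj_op J A)"
proof -
  have "bounded_linear (\<lambda>x. J (A (J x)))"
    using assms bounded_linear_compose[OF J_bounded_linear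
        bounded_linear_compose[OF _ J_bounded_linear, of A]]
    unfolding bounded_clinear_def by blast
  then show ?thesis
    using assms unfolding bounded_clinear_def clinear_iff conj_op_def
    by (simp add: J_add J_scaleC)
qed

lemma adj_conj_op: "adj (conj_op J A) = conj_op J (adj A)"
proof
  fix y
  have step: "\<forall>z\<in>UNIV. cinner (J x) z = cinner (J y) (conj_op J A z)"
    if "\<forall>z\<in>UNIV. cinner x z = cinner y (A z)" for x y A
    using that by (simp add: conj_op_def cinner_J_left J_J)
  have "\<forall>z\<in>UNIV. cinner (J x) z = cinner y (conj_op J A z)"
    if "\<forall>z\<in>UNIV. cinner x z = cinner (J y) (A z)" for x
    using step[OF that] by (simp add: J_J)
  moreover have "\<forall>z\<in>UNIV. cinner (J x) z = cinner (J y) (A z)"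
    if "\<forall>z\<in>UNIV. cinner x z = cinner y (conj_op J A z)" for x
    using step[OF that] by (simp add: conj_op_conj_op)
  ultimately show "adj (conj_op J A) y = conj_op J (adj A) y"
    unfolding conj_op_def[of J "adj A"] adj_on_def
    by (intro the_or_involution) (simp_all add: J_J J_zero)
qed

lemma self_adjoint_conj_op: "self_adjoint A \<Longrightarrow> self_adjoint (conj_op J A)"
  by (simp add: self_adjoint_def bounded_clinear_conj_op adj_conj_op)

lemma positive_op_conj_op: "positive_op A \<Longrightarrow> positive_op (conj_op J A)"
  unfolding positive_op_def
  by (auto simp: bounded_clinear_conj_op conj_op_def cinner_J_right less_eq_complex_def)

lemma orth_projection_conj_op: "orth_projection A \<Longrightarrow> orth_projection (conj_op J A)"
  unfolding orth_projection_def by (metis self_adjoint_conj_op conj_op_comp)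

lemma range_conj_op: "range (conj_op J A) = J ` range A"
  using range_comp_J[of "\<lambda>x. J (A x)"] by (simp add: conj_op_def[abs_def] image_image)

lemma op_kernel_conj_op: "op_kernel (conj_op J A) = J ` op_kernel A"
proof -
  have "J y = 0 \<longleftrightarrow> y = 0" for y using J_norm[of y] by (metis norm_eq_zero)
  then show ?thesis by (simp add: set_eq_iff J_image_iff op_kernel_def conj_op_def)
qed

lemma proj_onto_conj_op: "proj_onto (J ` S) = conj_op J (proj_onto S)"
proof -
  have step: "orth_projection (conj_op J Q) \<and> range (conj_op J Q) = J ` S"
    if "orth_projection Q \<and> range Q = S" for Q S
    using that by (simp add: orth_projection_conj_op range_conj_op)
  have "J ` J ` S = S" by (simp add: image_image J_J)
  then have "orth_projection (conj_op J Q) \<and> range (conj_op J Q) = S"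
    if "orth_projection Q \<and> range Q = J ` S" for Q
    using step[OF that] by simp
  with step show ?thesis
    unfolding proj_onto_def
    by (intro the_or_involution) (simp_all add: conj_op_conj_op conj_op_zero)
qed

lemma pos_part_conj_op: "pos_part (conj_op J A) = conj_op J (pos_part A)"
proof -
  let ?dec = "\<lambda>A Ap Am. positive_op Ap \<and> positive_op Am \<and>
    (\<forall>x. A x = Ap x - Am x) \<and> (\<forall>x. Ap (Am x) = 0)"
  have step: "?dec (conj_op J A) (conj_op J Ap) (conj_op J Am)" if "?dec A Ap Am" for A Ap Am
    using that by (auto simp: positive_op_conj_op conj_op_def J_diff J_J J_zero)
  show ?thesis
    unfolding pos_part_def
  proof (rule the_or_involution)
    show "\<exists>Am. ?dec (conj_op J A) (conj_op J Ap) Am" if "\<exists>Am. ?dec A Ap Am" for Ap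
      using that step by blast
    show "\<exists>Am. ?dec A (conj_op J Ap) Am" if "\<exists>Am. ?dec (conj_op J A) Ap Am" for Ap
    proof -
      from that obtain Am where "?dec (conj_op J A) Ap Am" by blast
      from step[OF this] show ?thesis unfolding conj_op_conj_op by blast
    qed
  qed (simp_all add: conj_op_conj_op conj_op_zero)
qed

lemma inverse_on_range_conj_op:
  "inverse_on_range (conj_op J T) = conj_op J (inverse_on_range T)"
proof
  fix y
  let ?inv = "\<lambda>T y x. x \<in> range T \<and> (\<exists>z. (\<forall>u. cinner (T u) z = 0) \<and> y = T x + z)"
  have step: "?inv (conj_op J T) (J y) (J x)" if inv: "?inv T y x" for T y x
  proof -
    obtain z where z: "\<forall>u. cinner (T u) z = 0" "y = T x + z" using inv by blast
    have "\<forall>u. cinner (conj_op J T u) (J z) = 0" "J y = conj_op J T (J x) + J z"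
      using z by (simp_all add: conj_op_def J_cinner J_add J_J)
    moreover have "J x \<in> range (conj_op J T)"
      using inv by (simp add: range_conj_op J_image_iff J_J)
    ultimately show ?thesis by blast
  qed
  have "?inv (conj_op J T) y (J x)" if "?inv T (J y) x" for x
    using step[OF that] by (simp add: J_J)
  moreover have "?inv T (J y) (J x)" if "?inv (conj_op J T) y x" for x
    using step[OF that] by (simp add: conj_op_conj_op)
  ultimately show "inverse_on_range (conj_op J T) y = conj_op J (inverse_on_range T) y"
    unfolding conj_op_def[of J "inverse_on_range T"] inverse_on_range_def
    by (intro the_or_involution) (auto simp: J_J J_zero)
qed

lemma cspan_J_image: "cspan (J ` S) = J ` cspan S"
proof (rule involution_image_commute)
  show "J ` cspan S \<subseteq> cspan (J ` S)" for S
  proof clarify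
    fix x assume "x \<in> cspan S"
    then show "J x \<in> cspan (J ` S)"
      by (induction rule: complex_vector.span_induct_alt)
        (simp_all add: J_zero J_add J_scaleC complex_vector.span_zero
          complex_vector.span_add complex_vector.span_scale complex_vector.span_base)
  qed
qed (rule J_J)

lemma closure_J_image: "closure (J ` S) = J ` closure S"
proof (rule involution_image_commute)
  have cont: "continuous_on T J" for T using J_bounded_linear by (rule linear_continuous_on)
  show "J ` closure S \<subseteq> closure (J ` S)" for S
    by (rule image_closure_subset[OF cont closed_closure closure_subset])
qed (rule J_J)

text \<open>The image under \<open>J\<close> of an orthonormal basis witnessing the Hilbert-Schmidt property for
  \<open>T\<close> is a witness for the conjugated operator, with the same sum.\<close>

lemma hilbert_schmidt_conj_op:
  assumes "hilbert_schmidt T"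
  shows "hilbert_schmidt (conj_op J T)"
proof -
  from assms obtain B where T: "bounded_clinear T" and B: "orthonormal_basis B"
    and sum: "(\<lambda>e. (norm (T e))\<^sup>2) summable_on B"
    unfolding hilbert_schmidt_def by blast
  have "orthonormal_basis (J ` B)"
    using B bij_J unfolding orthonormal_basis_def cspan_J_image closure_J_image
    by (auto simp: J_cinner bij_def dest: injD split: if_splits)
  moreover have "inj_on J B" using bij_J by (auto simp: bij_def inj_on_def)
  then have "(\<lambda>e. (norm (conj_op J T e))\<^sup>2) summable_on J ` B"
    using sum by (simp add: summable_on_reindex comp_def conj_op_def J_J J_norm)
  ultimately show ?thesis
    using bounded_clinear_conj_op[OF T] unfolding hilbert_schmidt_def by blast
qed

lemma unitary_conj_op:
  assumes "unitary U"
  shows "unitary (conj_op J U)"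
proof -
  have "bij (J \<circ> U \<circ> J)"
    using assms bij_J unfolding unitary_between_def by (blast intro: bij_comp)
  then show ?thesis
    using assms unfolding unitary_between_def
    by (auto simp: conj_op_def[abs_def] comp_def J_add J_scaleC J_cinner)
qed

lemma unitary_group_conj_op:
  assumes "unitary_group U"
  shows "unitary_group (\<lambda>t. conj_op J (U t))"
proof -
  have "continuous_on UNIV (\<lambda>t. J (U t (J x)))" for x
    using assms J_bounded_linear unfolding unitary_group_def
    by (intro bounded_linear.continuous_on[of J]) auto
  then show ?thesis
    using assms unfolding unitary_group_def
    by (simp add: unitary_conj_op conj_op_comp[symmetric]) (simp add: conj_op_def)
qed

lemma generator_graph_conj_op:
  "generator_graph (\<lambda>t. conj_op J (U t)) = map_prod J J ` generator_graph U"
proof -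
  have step: "(J x, J y) \<in> generator_graph (\<lambda>t. conj_op J (U t))"
    if "(x, y) \<in> generator_graph U" for x y U
  proof -
    have "((\<lambda>t. J ((U t x - x) /\<^sub>R t)) \<longlongrightarrow> J y) (at 0)"
      using that by (intro bounded_linear.tendsto[OF J_bounded_linear])
        (simp add: generator_graph_def)
    then show ?thesis
      by (simp add: generator_graph_def conj_op_def J_J J_scaleR J_diff)
  qed
  show ?thesis
  proof (intro equalityI subsetI)
    fix p assume "p \<in> generator_graph (\<lambda>t. conj_op J (U t))"
    then have "(J (fst p), J (snd p)) \<in> generator_graph U"
      using step[of "fst p" "snd p" "\<lambda>t. conj_op J (U t)"] by (simp add: conj_op_conj_op)
    then show "p \<in> map_prod J J ` generator_graph U"
      by (intro image_eqI[where x = "(J (fst p), J (snd p))"]) (simp_all add: J_J)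
  next
    fix p assume "p \<in> map_prod J J ` generator_graph U"
    then show "p \<in> generator_graph (\<lambda>t. conj_op J (U t))" by (auto intro: step)
  qed
qed

text \<open>An antilinear map commutes with real scalars. So it respects the real parameter of a unitary
  group and the difference quotients that define the generator.\<close>

lemma op_exp_conj_op: "op_exp (map_prod J J ` T) = conj_op J (op_exp T)"
proof -
  let ?e = "\<lambda>T W. \<exists>U. unitary_group U \<and> generator_graph U = T \<and> W = U 1"
  have step: "?e (map_prod J J ` T) (conj_op J W)" if "?e T W" for T W
    using that unitary_group_conj_op generator_graph_conj_op by blast
  have "map_prod J J ` map_prod J J ` T = T"
    by (simp add: image_image prod.map_comp comp_def J_J)
  then have "?e T (conj_op J W)" if "?e (map_prod J J ` T) W" for W
    using step[OF that] by simp
  then show ?thesis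
    unfolding op_exp_def
    by (intro the_or_involution) (simp_all add: conj_op_conj_op conj_op_zero step)
qed

lemma onorm_conj_op: "onorm (conj_op J A) = onorm A"
proof -
  have "range (\<lambda>x. norm (conj_op J A x) / norm x) = range (\<lambda>x. norm (A x) / norm x)"
    using range_comp_J[of "\<lambda>x. norm (A x) / norm x"] by (simp add: conj_op_def J_norm)
  then show ?thesis unfolding onorm_def by simp
qed

lemma cstar_subalgebra_conj_op:
  assumes A: "cstar_subalgebra A"
  shows "cstar_subalgebra (conj_op J ` A)"
  unfolding cstar_subalgebra_def conj_op_image_iff
proof (intro conjI allI impI ballI; (elim conjE)?)
  show "conj_op J ` A \<noteq> {}" using A unfolding cstar_subalgebra_def by blast
  show "bounded_clinear a" if "a \<in> conj_op J ` A" for a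
    using that A bounded_clinear_conj_op unfolding cstar_subalgebra_def by blast
  fix a assume a: "a \<in> conj_op J ` A"
  show "conj_op J (\<lambda>x. a x + b x) \<in> A" if "b \<in> conj_op J ` A" for b
    using a that A unfolding conj_op_image_iff conj_op_add cstar_subalgebra_def by blast
  show "conj_op J (\<lambda>x. c *\<^sub>C a x) \<in> A" for c
    using a A unfolding conj_op_image_iff conj_op_scaleC cstar_subalgebra_def by blast
  show "conj_op J (a \<circ> b) \<in> A" if "b \<in> conj_op J ` A" for b
    using a that A unfolding conj_op_image_iff conj_op_comp cstar_subalgebra_def by blast
  show "conj_op J (adj a) \<in> A"
    using a A unfolding conj_op_image_iff adj_conj_op[symmetric] cstar_subalgebra_def by blast
next
  fix s a
  assume s: "\<forall>n. conj_op J (s n) \<in> A" and a: "bounded_clinear a"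
    and lim: "(\<lambda>n::nat. onorm (\<lambda>x. s n x - a x)) \<longlonglongrightarrow> 0"
  have "onorm (\<lambda>x. conj_op J (s n) x - conj_op J a x) = onorm (\<lambda>x. s n x - a x)" for n
    using onorm_conj_op[of "\<lambda>x. s n x - a x"] by (simp add: conj_op_diff)
  with lim have "(\<lambda>n. onorm (\<lambda>x. conj_op J (s n) x - conj_op J a x)) \<longlonglongrightarrow> 0" by simp
  moreover have "\<forall>s a. (\<forall>n::nat. s n \<in> A) \<and> bounded_clinear a \<and>
       (\<lambda>n. onorm (\<lambda>x. s n x - a x)) \<longlonglongrightarrow> 0 \<longrightarrow> a \<in> A"
    using A unfolding cstar_subalgebra_def by (elim conjE)
  ultimately show "conj_op J a \<in> A"
    using s bounded_clinear_conj_op[OF a] by (simp del: imp_ex)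
qed

lemma cstar_generated_conj_op:
  "cstar_generated (conj_op J ` S) = conj_op J ` cstar_generated S"
proof (rule involution_image_commute)
  show "conj_op J ` cstar_generated S \<subseteq> cstar_generated (conj_op J ` S)" for S
  proof clarify
    fix a assume a: "a \<in> cstar_generated S"
    show "conj_op J a \<in> cstar_generated (conj_op J ` S)"
      unfolding cstar_generated_def
    proof clarify
      fix A assume A: "cstar_subalgebra A" "conj_op J ` S \<subseteq> A"
      from image_mono[OF A(2), of "conj_op J"] have "S \<subseteq> conj_op J ` A"
        by (simp add: image_image conj_op_conj_op)
      with a cstar_subalgebra_conj_op[OF A(1)] have "a \<in> conj_op J ` A"
        unfolding cstar_generated_def by blast
      then show "conj_op J a \<in> A" by (simp add: conj_op_image_iff)
    qed
  qed
qed (rule conj_op_conj_op)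

text \<open>The conjugated map is linear since the two conjugations contribute one antilinearity each.\<close>

lemma star_endomorphism_conj_op:
  assumes "star_endomorphism A \<rho>"
  shows "star_endomorphism (conj_op J ` A) (\<lambda>a. conj_op J (\<rho> (conj_op J a)))"
  using assms unfolding star_endomorphism_def ball_simps(9)
  by (simp add: conj_op_conj_op conj_op_add conj_op_scaleC conj_op_comp adj_conj_op)

end


section \<open>Conjugations of a selfdual CCR space\<close>

context ccr_space
begin

lemma P1_add: "P1 (f + g) = P1 f + P1 g"
  and P1_scaleC: "P1 (c *\<^sub>C f) = c *\<^sub>C P1 f"
  and P1_P1: "P1 (P1 f) = P1 f"
  and form_P1: "\<kappa> f (P1 g) = \<kappa> (P1 f) g"
  and star_P1_star: "star (P1 (star f)) = f - P1 f"
proof -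
  note * = P1_basis_projection[unfolded basis_projection_def clinear_iff]
  show "P1 (f + g) = P1 f + P1 g" "P1 (c *\<^sub>C f) = c *\<^sub>C P1 f" "\<kappa> f (P1 g) = \<kappa> (P1 f) g"
    using * by blast+
  show "P1 (P1 f) = P1 f" using * by (metis comp_apply)
  have "P1 f + star (P1 (star f)) = f" using * unfolding conj_op_def by blast
  then show "star (P1 (star f)) = f - P1 f" by (simp add: algebra_simps)
qed

lemma P1_minus: "P1 (- f) = - P1 f"
  using P1_scaleC[of "- 1" f] by (simp add: scaleC_minus_one)

lemma P1_diff: "P1 (f - g) = P1 f - P1 g"
  using P1_add[of f "- g"] by (simp add: P1_minus)

lemma P1_star: "P1 (star f) = star (P2 f)"
  unfolding P2_def star_P1_star[of f, symmetric] by (simp add: star_star)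

lemma star_minus: "star (- f) = - star f"
  using star_scaleC[of "- 1" f] by (simp add: scaleC_minus_one)

lemma star_diff: "star (f - g) = star f - star g"
  using star_add[of f "- g"] by (simp add: star_minus)

lemma P2_star: "P2 (star f) = star (P1 f)"
  by (simp add: P2_def P1_star star_diff)

lemma C_star: "C (star f) = - star (C f)"
  by (simp add: C_def P1_star P2_star star_diff)

lemma cinner_form_C: "cinner f g = \<kappa> f (C g)"
  by (simp add: cinner_form C_def P2_def)

lemma C_C: "C (C f) = f"
  by (simp add: C_def P2_def P1_diff P1_add P1_P1)

lemma cinner_P1: "cinner f (P1 g) = cinner (P1 f) g"
  by (simp add: cinner_form_C form_P1[symmetric]) (simp add: C_def P2_def P1_diff P1_P1)

text \<open>The sign in \<open>\<kappa> (star f) (star g) = - \<kappa> g f\<close> cancels against the one from \<open>C\<close>.\<close>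

lemma star_conjugation: "conjugation star"
proof
  show "cinner (star f) (star g) = cnj (cinner f g)" for f g
  proof -
    have "cinner (star f) (star g) = \<kappa> (star f) (star (- C g))"
      by (simp add: cinner_form_C C_star star_minus)
    also have "\<dots> = - \<kappa> (- C g) f" by (rule form_star)
    also have "\<dots> = - cnj (\<kappa> f (- C g))" by (simp add: form_hermitian[of "- C g" f])
    also have "\<kappa> f (- C g) = - cinner f g"
      using form_scaleC_right[of f "- 1" "C g"] by (simp add: scaleC_minus_one cinner_form_C)
    finally show ?thesis by simp
  qed
qed (simp_all add: star_add star_scaleC star_star)

end

text \<open>A conjugation that commutes with \<open>P1\<close> and \<open>star\<close> respects the whole structure of the
  selfdual CCR space, up to complex conjugation of the form.\<close>

locale ccr_conjugation = ccr_space \<kappa> star P1 + conjugation J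
  for \<kappa> :: "'k::chilbert_space \<Rightarrow> 'k \<Rightarrow> complex" and star P1 and J :: "'k \<Rightarrow> 'k" +
  assumes P1_J: "P1 (J f) = J (P1 f)"
    and star_J: "star (J f) = J (star f)"
begin

lemma conj_op_P1: "conj_op J P1 = P1"
  and conj_op_P2: "conj_op J P2 = P2"
  and conj_op_C: "conj_op J C = C"
  by (simp_all add: fun_eq_iff conj_op_def C_def P2_def P1_J J_J J_diff)

lemma dagger_conj_op: "dagger (conj_op J A) = conj_op J (dagger A)"
  by (simp add: dagger_def conj_op_comp conj_op_C adj_conj_op)

lemma A_plus_conj_op: "A_plus (conj_op J V) = conj_op J (A_plus V)"
  by (simp add: A_plus_def Let_def dagger_conj_op op_kernel_conj_op proj_onto_conj_op
      pos_part_conj_op[symmetric] conj_op_comp conj_op_C)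

lemma P_V_conj_op: "P_V (conj_op J V) = conj_op J (P_V V)"
proof
  fix f
  have C: "J (C x) = C (J x)" for x
    using conj_op_C unfolding conj_op_fixed_iff by blast
  show "P_V (conj_op J V) f = conj_op J (P_V V) f"
    unfolding P_V_def A_plus_conj_op inverse_on_range_conj_op dagger_conj_op
    by (simp add: conj_op_def P_V_def J_add J_J P1_J C)
qed

lemma frak_k_conj_op: "frak_k (conj_op J V) = J ` frak_k V"
  by (simp add: frak_k_def P_V_conj_op dagger_conj_op op_kernel_conj_op image_image
      conj_op_def[of J "P_V V"] J_J)

lemma bogoliubov_conj_op:
  assumes "V \<in> bogoliubov"
  shows "conj_op J V \<in> bogoliubov"
proof -
  from assms have V: "bounded_clinear V" "conj_op star V = V" "dagger V \<circ> V = id"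
    unfolding bogoliubov_def by auto
  have "conj_op star (conj_op J V) = conj_op J (conj_op star V)"
    by (simp add: fun_eq_iff conj_op_def star_J)
  moreover have "dagger (conj_op J V) \<circ> conj_op J V = conj_op J (dagger V \<circ> V)"
    by (simp add: dagger_conj_op conj_op_comp)
  moreover have "conj_op J id = id" by (simp add: fun_eq_iff conj_op_def J_J)
  ultimately show ?thesis
    unfolding bogoliubov_def using V by (simp add: bounded_clinear_conj_op)
qed

text \<open>The Hilbert-Schmidt condition is preserved because the off-diagonal block of the conjugated
  operator is the conjugate of the off-diagonal block.\<close>

lemma bogoliubov_P1_G_conj_op:
  assumes V: "V \<in> bogoliubov_P1_G G" and G: "\<And>U. U \<in> G \<Longrightarrow> conj_op J U = U"
  shows "conj_op J V \<in> bogoliubov_P1_G G"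
proof -
  have "hilbert_schmidt (P1 \<circ> conj_op J V \<circ> P2)"
    using V hilbert_schmidt_conj_op[of "P1 \<circ> V \<circ> P2"]
    by (simp add: bogoliubov_P1_G_def bogoliubov_P1_def conj_op_comp conj_op_P1 conj_op_P2)
  moreover have "conj_op J V \<circ> U = U \<circ> conj_op J V" if "U \<in> G" for U
  proof -
    have "V \<circ> U = U \<circ> V" using V that by (simp add: bogoliubov_P1_G_def)
    then have "conj_op J V \<circ> conj_op J U = conj_op J U \<circ> conj_op J V"
      by (simp add: conj_op_comp[symmetric])
    then show ?thesis by (simp add: G[OF that])
  qed
  ultimately show ?thesis
    using V bogoliubov_conj_op unfolding bogoliubov_P1_G_def bogoliubov_P1_def by blast
qed

end


section \<open>Second quantization of a conjugation\<close>

lemma norm_scaleC: "norm (c *\<^sub>C x) = cmod c * norm (x :: 'a::complex_inner)"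
proof -
  have "complex_of_real ((norm (c *\<^sub>C x))\<^sup>2) = (cnj c * c) * complex_of_real ((norm x)\<^sup>2)"
    unfolding cinner_self_norm[symmetric] by (simp add: cinner_scaleC_left cinner_scaleC_right)
  also have "cnj c * c = complex_of_real ((cmod c)\<^sup>2)"
    by (metis complex_norm_square mult.commute)
  finally have "(norm (c *\<^sub>C x))\<^sup>2 = (cmod c * norm x)\<^sup>2"
    unfolding of_real_mult[symmetric] of_real_eq_iff power_mult_distrib .
  then show ?thesis by (simp add: power2_eq_iff_nonneg)
qed

lemma scaleC_bounded_linear: "bounded_linear (\<lambda>x :: 'a::complex_inner. c *\<^sub>C x)"
  by (rule bounded_linear_intro[where K = "cmod c"])
    (simp_all add: scaleC_add_right scaleR_scaleC scaleC_scaleC mult.commute norm_scaleC)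

text \<open>The closure of the graph is again the graph of an isometry, because isometries map Cauchy
  sequences to Cauchy sequences; its symmetry makes the resulting map an involution, hence
  surjective.\<close>

lemma conjugation_of_dense_graph:
  fixes R :: "('a::chilbert_space \<times> 'a) set"
  assumes add: "\<And>x y x' y'. (x, y) \<in> R \<Longrightarrow> (x', y') \<in> R \<Longrightarrow> (x + x', y + y') \<in> R"
    and scale: "\<And>x y c. (x, y) \<in> R \<Longrightarrow> (c *\<^sub>C x, cnj c *\<^sub>C y) \<in> R"
    and swap: "\<And>x y. (x, y) \<in> R \<Longrightarrow> (y, x) \<in> R"
    and isometric: "\<And>x y. (x, y) \<in> R \<Longrightarrow> norm y = norm x"
    and dense: "closure (fst ` R) = UNIV"
  shows "\<exists>J. conjugation J \<and> (\<forall>(x, y)\<in>R. J x = y)"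
proof -
  define D where "D = closure R"
  have limD: "(x, y) \<in> D" if "\<And>n. (X n, Y n) \<in> R" "X \<longlonglongrightarrow> x" "Y \<longlonglongrightarrow> y" for X Y x y
    unfolding D_def closure_sequential
    using that by (intro exI[of _ "\<lambda>n. (X n, Y n)"]) (auto intro: tendsto_Pair)
  have Dlim: "\<exists>X Y. (\<forall>n. (X n, Y n) \<in> R) \<and> X \<longlonglongrightarrow> x \<and> Y \<longlonglongrightarrow> y" if xy: "(x, y) \<in> D" for x y
  proof -
    from xy obtain S where "\<forall>n. S n \<in> R" "S \<longlonglongrightarrow> (x, y)"
      unfolding D_def closure_sequential by blast
    then show ?thesis
      using tendsto_fst[of S "(x, y)"] tendsto_snd[of S "(x, y)"]
      by (intro exI[of _ "\<lambda>n. fst (S n)"] exI[of _ "\<lambda>n. snd (S n)"]) simp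
  qed
  have D_add: "(x + x', y + y') \<in> D" if xy: "(x, y) \<in> D" and xy': "(x', y') \<in> D" for x y x' y'
  proof -
    from Dlim[OF xy] obtain X Y where R: "\<And>n. (X n, Y n) \<in> R" "X \<longlonglongrightarrow> x" "Y \<longlonglongrightarrow> y" by blast
    from Dlim[OF xy'] obtain X' Y' where R': "\<And>n. (X' n, Y' n) \<in> R" "X' \<longlonglongrightarrow> x'" "Y' \<longlonglongrightarrow> y'"
      by blast
    show ?thesis
      by (rule limD[OF add[OF R(1) R'(1)] tendsto_add[OF R(2) R'(2)] tendsto_add[OF R(3) R'(3)]])
  qed
  have D_scale: "(c *\<^sub>C x, cnj c *\<^sub>C y) \<in> D" if xy: "(x, y) \<in> D" for x y c
  proof -
    from Dlim[OF xy] obtain X Y where R: "\<And>n. (X n, Y n) \<in> R" "X \<longlonglongrightarrow> x" "Y \<longlonglongrightarrow> y" by blast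
    show ?thesis
      by (rule limD[OF scale[OF R(1)] bounded_linear.tendsto[OF scaleC_bounded_linear R(2)]
            bounded_linear.tendsto[OF scaleC_bounded_linear R(3)]])
  qed
  have D_swap: "(y, x) \<in> D" if xy: "(x, y) \<in> D" for x y
  proof -
    from Dlim[OF xy] obtain X Y where R: "\<And>n. (X n, Y n) \<in> R" "X \<longlonglongrightarrow> x" "Y \<longlonglongrightarrow> y" by blast
    show ?thesis by (rule limD[OF swap[OF R(1)] R(3) R(2)])
  qed
  have D_norm: "norm y = norm x" if xy: "(x, y) \<in> D" for x y
  proof -
    from Dlim[OF xy] obtain X Y where R: "\<And>n. (X n, Y n) \<in> R" "X \<longlonglongrightarrow> x" "Y \<longlonglongrightarrow> y" by blast
    have "(\<lambda>n. norm (Y n)) = (\<lambda>n. norm (X n))" by (rule ext) (rule isometric[OF R(1)])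
    then show ?thesis
      using tendsto_norm[OF R(2)] tendsto_norm[OF R(3)] by (metis LIMSEQ_unique)
  qed
  have diff: "norm (y - y') = norm (x - x')" if xy: "(x, y) \<in> D" and xy': "(x', y') \<in> D" for x y x' y'
    using D_norm[OF D_add[OF xy D_scale[OF xy', of "- 1"]]] by (simp add: scaleC_minus_one)
  have D_total: "\<exists>y. (x, y) \<in> D" for x
  proof -
    have "x \<in> closure (fst ` R)" using dense by simp
    then obtain X where X: "\<And>n. X n \<in> fst ` R" "X \<longlonglongrightarrow> x"
      unfolding closure_sequential by blast
    have "\<exists>y. (X n, y) \<in> R" for n using X(1)[of n] by force
    then obtain Y where Y: "\<And>n. (X n, Y n) \<in> R" by metis
    then have "(X n, Y n) \<in> D" for n unfolding D_def using closure_subset by blast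
    from diff[OF this this] have "dist (Y m) (Y n) = dist (X m) (X n)" for m n
      by (simp add: dist_norm)
    moreover have "Cauchy X" using X(2) by (rule LIMSEQ_imp_Cauchy)
    ultimately have "Cauchy Y" unfolding Cauchy_def by simp
    then obtain y where "Y \<longlonglongrightarrow> y" using Cauchy_convergent convergent_def by blast
    with limD[OF Y X(2)] show ?thesis by blast
  qed
  have D_unique: "y = y'" if xy: "(x, y) \<in> D" "(x, y') \<in> D" for x y y'
    using diff[OF xy] by simp
  from D_total obtain J where J: "\<And>x. (x, J x) \<in> D" by metis
  note J_eq = D_unique[OF J]
  have J_add: "J (x + y) = J x + J y" for x y using J_eq[OF D_add[OF J J]] .
  have J_scale: "J (c *\<^sub>C x) = cnj c *\<^sub>C J x" for c x using J_eq[OF D_scale[OF J]] .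
  have "conjugation J"
  proof
    show "J (J x) = x" for x using J_eq[OF D_swap[OF J]] .
    show "cinner (J x) (J y) = cnj (cinner x y)" for x y
      by (rule antilinear_isometry_cinner[OF J_add J_scale D_norm[OF J]])
  qed (fact J_add J_scale)+
  moreover have "J x = y" if "(x, y) \<in> R" for x y
    using J_eq[of x y] that closure_subset[of R] unfolding D_def by blast
  ultimately show ?thesis by blast
qed

lemma lin_ext_on_uminus:
  assumes "\<And>i. i \<in> I \<Longrightarrow> t' i = - t i"
  shows "lin_ext_on I e t' x = - lin_ext_on I e t x"
proof -
  let ?ext = "\<lambda>t y. \<exists>S c. finite S \<and> S \<subseteq> I \<and> x = (\<Sum>i\<in>S. c i *\<^sub>C e i) \<and> y = (\<Sum>i\<in>S. c i *\<^sub>C t i)"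
  have step: "?ext t' (- y)" if neg: "\<And>i. i \<in> I \<Longrightarrow> t' i = - t i" and y: "?ext t y" for t t' y
  proof -
    from y obtain S c where S: "finite S" "S \<subseteq> I" "x = (\<Sum>i\<in>S. c i *\<^sub>C e i)"
      and y: "y = (\<Sum>i\<in>S. c i *\<^sub>C t i)" by blast
    have "(\<Sum>i\<in>S. c i *\<^sub>C t' i) = (\<Sum>i\<in>S. - (c i *\<^sub>C t i))"
      using S(2) neg by (intro sum.cong) auto
    then have "- y = (\<Sum>i\<in>S. c i *\<^sub>C t' i)" unfolding y by (simp add: sum_negf)
    with S show ?thesis by blast
  qed
  have neg': "t i = - t' i" if "i \<in> I" for i using assms[OF that] by simp
  have "?ext t' (- y)" if "?ext t y" for y using step[OF assms that] .
  moreover have "?ext t (- y)" if "?ext t' y" for y using step[OF neg' that] .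
  ultimately show ?thesis
    unfolding lin_ext_on_def by (intro the_or_involution[OF minus_minus minus_zero])
qed

text \<open>\<open>\<phi>\<close> is the permutation of the index set that \<open>J\<close> induces on the spanning family.\<close>

lemma (in conjugation) lin_ext_on_conj:
  fixes \<phi> :: "'i \<Rightarrow> 'i"
  assumes inv: "\<And>i. \<phi> (\<phi> i) = i" and I: "\<And>i. i \<in> I \<Longrightarrow> \<phi> i \<in> I"
    and e: "\<And>i. i \<in> I \<Longrightarrow> J (e i) = e (\<phi> i)" and t: "\<And>i. i \<in> I \<Longrightarrow> J (t i) = t' (\<phi> i)"
  shows "J (lin_ext_on I e t x) = lin_ext_on I e t' (J x)"
proof -
  let ?ext = "\<lambda>t x y. \<exists>S c. finite S \<and> S \<subseteq> I \<and> x = (\<Sum>i\<in>S. c i *\<^sub>C e i) \<and> y = (\<Sum>i\<in>S. c i *\<^sub>C t i)"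
  have step: "?ext t' (J x) (J y)"
    if t: "\<And>i. i \<in> I \<Longrightarrow> J (t i) = t' (\<phi> i)" and ext: "?ext t x y" for t t' x y
  proof -
    from ext obtain S c where S: "finite S" "S \<subseteq> I"
      and x: "x = (\<Sum>i\<in>S. c i *\<^sub>C e i)" and y: "y = (\<Sum>i\<in>S. c i *\<^sub>C t i)" by blast
    have "inj_on \<phi> S" using inv by (metis inj_onI)
    then have reindex: "(\<Sum>i\<in>\<phi> ` S. g i) = (\<Sum>i\<in>S. g (\<phi> i))" for g :: "'i \<Rightarrow> 'a"
      by (simp add: sum.reindex)
    have Jx: "J x = (\<Sum>i\<in>\<phi> ` S. cnj (c (\<phi> i)) *\<^sub>C e i)"
      using S e unfolding x reindex inv J_sum J_scaleC by (intro sum.cong) auto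
    have Jy: "J y = (\<Sum>i\<in>\<phi> ` S. cnj (c (\<phi> i)) *\<^sub>C t' i)"
      using S t unfolding y reindex inv J_sum J_scaleC by (intro sum.cong) auto
    have "finite (\<phi> ` S)" "\<phi> ` S \<subseteq> I" using S I by auto
    then show ?thesis
      by (intro exI[of _ "\<phi> ` S"] exI[of _ "\<lambda>i. cnj (c (\<phi> i))"] conjI Jx Jy)
  qed
  have t': "J (t' i) = t (\<phi> i)" if "i \<in> I" for i
    using t[OF I[OF that]] inv J_J by metis
  have forth: "?ext t' (J x) (J y)" if "?ext t x y" for y
    using step[OF t that] .
  have converse: "?ext t x (J y)" if "?ext t' (J x) y" for y
    using step[OF t' that] by (simp only: J_J)
  show ?thesis
    unfolding lin_ext_on_def
    by (rule the_or_involution[OF J_J J_zero, symmetric]) (rule forth converse, assumption)+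
qed

locale fock_conjugation = fock_space \<kappa> star P1 tens + ccr_conjugation \<kappa> star P1 J
  for \<kappa> :: "'k::chilbert_space \<Rightarrow> 'k \<Rightarrow> complex" and star P1
    and tens :: "'k list \<Rightarrow> 'f::chilbert_space" and J :: "'k \<Rightarrow> 'k"
begin

lemma map_J_in_lists: "fs \<in> lists (range P1) \<Longrightarrow> map J fs \<in> lists (range P1)"
  by (induction fs) (auto simp: P1_J[symmetric])

lemma map_J_map_J: "map J (map J fs) = fs"
  by (simp add: comp_def J_J)

lemma cinner_tens_J:
  assumes "fs \<in> lists (range P1)" "gs \<in> lists (range P1)"
  shows "cinner (tens (map J fs)) (tens (map J gs)) = cnj (cinner (tens fs) (tens gs))"
proof (cases "length fs = length gs")
  case True
  have "cinner (map J fs ! i) (map J gs ! \<sigma> i) = cnj (cinner (fs ! i) (gs ! \<sigma> i))"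
    if "\<sigma> permutes {..<length fs}" "i < length fs" for \<sigma> i
  proof -
    have "\<sigma> i < length gs" using permutes_in_image[OF that(1), of i] that(2) True by simp
    then show ?thesis using that(2) by (simp add: J_cinner)
  qed
  then have "(\<Prod>i<length fs. cinner (map J fs ! i) (map J gs ! \<sigma> i))
      = (\<Prod>i<length fs. cnj (cinner (fs ! i) (gs ! \<sigma> i)))"
    if "\<sigma> permutes {..<length fs}" for \<sigma>
    using that by (intro prod.cong) auto
  then have "(\<Sum>\<sigma> | \<sigma> permutes {..<length fs}. \<Prod>i<length fs. cinner (map J fs ! i) (map J gs ! \<sigma> i))
      = (\<Sum>\<sigma> | \<sigma> permutes {..<length fs}. \<Prod>i<length fs. cnj (cinner (fs ! i) (gs ! \<sigma> i)))"
    by (intro sum.cong) auto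
  with True show ?thesis
    by (simp only: cinner_tens map_J_in_lists assms length_map if_True refl cnj_sum cnj_prod)
qed (simp add: cinner_tens map_J_in_lists assms)

text \<open>The graph of the antilinear map on algebraic tensors with \<open>tens fs \<mapsto> tens (map J fs)\<close>. As
  a relation it needs no choice of representations of a vector by tensors; that it is
  single-valued follows from \<open>cinner_tens_J\<close>.\<close>

inductive_set tensor_graph :: "('f \<times> 'f) set" where
  zero: "(0, 0) \<in> tensor_graph"
| step: "(x, y) \<in> tensor_graph \<Longrightarrow> fs \<in> lists (range P1) \<Longrightarrow>
    (c *\<^sub>C tens fs + x, cnj c *\<^sub>C tens (map J fs) + y) \<in> tensor_graph"

lemma tensor_graph_cinner:
  assumes "(x, y) \<in> tensor_graph" "(x', y') \<in> tensor_graph"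
  shows "cinner y y' = cnj (cinner x x')"
proof -
  have zero_right: "cinner z 0 = 0" for z :: 'f using cinner_diff_right[of z 0 0] by simp
  have tens: "cinner y (tens (map J gs)) = cnj (cinner x (tens gs))"
    if "gs \<in> lists (range P1)" for gs
    using assms(1)
    by induction (simp_all add: cinner_zero_left cinner_add_left cinner_scaleC_left
        cinner_tens_J that)
  from assms(2) show ?thesis
    by induction (simp_all add: zero_right cinner_add_right cinner_scaleC_right tens)
qed

lemma tensor_graph_add:
  assumes "(x, y) \<in> tensor_graph" "(x', y') \<in> tensor_graph"
  shows "(x + x', y + y') \<in> tensor_graph"
  using assms
proof induction
  case (step x y fs c)
  then have "(c *\<^sub>C tens fs + (x + x'), cnj c *\<^sub>C tens (map J fs) + (y + y')) \<in> tensor_graph"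
    by (intro tensor_graph.step) auto
  then show ?case by (simp only: add.assoc)
qed simp

lemma tensor_graph_scale:
  assumes "(x, y) \<in> tensor_graph"
  shows "(a *\<^sub>C x, cnj a *\<^sub>C y) \<in> tensor_graph"
  using assms
proof induction
  case (step x y fs c)
  from tensor_graph.step[OF step.IH step.hyps(2), of "a * c"]
  show ?case by (simp add: scaleC_add_right scaleC_scaleC)
qed (simp add: tensor_graph.zero)

lemma tensor_graph_swap:
  assumes "(x, y) \<in> tensor_graph"
  shows "(y, x) \<in> tensor_graph"
  using assms
proof induction
  case (step x y fs c)
  from tensor_graph.step[OF step.IH map_J_in_lists[OF step.hyps(2)], of "cnj c"]
  show ?case by (simp only: map_J_map_J complex_cnj_cnj)
qed (rule tensor_graph.zero)

lemma tensor_graph_dense: "closure (fst ` tensor_graph) = UNIV"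
proof -
  have "cspan (tens ` lists (range P1)) \<subseteq> fst ` tensor_graph"
  proof
    fix x assume "x \<in> cspan (tens ` lists (range P1))"
    then show "x \<in> fst ` tensor_graph"
    proof (induction rule: complex_vector.span_induct_alt)
      case base
      show ?case using tensor_graph.zero by force
    next
      case (step c z x)
      from step.IH obtain y where y: "(x, y) \<in> tensor_graph" by auto
      from step.hyps obtain fs where "fs \<in> lists (range P1)" "z = tens fs" by blast
      with tensor_graph.step[OF y this(1), of c] show ?case by force
    qed
  qed
  from closure_mono[OF this] show ?thesis unfolding tens_total by blast
qed

definition fock_conj :: "'f \<Rightarrow> 'f"
  where "fock_conj = (SOME \<Theta>. conjugation \<Theta> \<and> (\<forall>(x, y)\<in>tensor_graph. \<Theta> x = y))"

lemma fock_conj: "conjugation fock_conj"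
  and fock_conj_eq: "(x, y) \<in> tensor_graph \<Longrightarrow> fock_conj x = y"
proof -
  have "\<exists>\<Theta>. conjugation \<Theta> \<and> (\<forall>(x, y)\<in>tensor_graph. \<Theta> x = y)"
  proof (rule conjugation_of_dense_graph[OF tensor_graph_add tensor_graph_scale
        tensor_graph_swap _ tensor_graph_dense])
    fix x y assume "(x, y) \<in> tensor_graph"
    from tensor_graph_cinner[OF this this] have "cinner y y = cinner x x"
      by (metis cinner_commute)
    then show "norm y = norm x" by (rule norm_eq_if_cinner_self_eq)
  qed
  note * = someI_ex[OF this, folded fock_conj_def]
  from * show "conjugation fock_conj" by blast
  from * show "fock_conj x = y" if "(x, y) \<in> tensor_graph" using that by fast
qed

sublocale Fock: conjugation fock_conj
  by (rule fock_conj)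

lemma fock_conj_tens:
  assumes "fs \<in> lists (range P1)"
  shows "fock_conj (tens fs) = tens (map J fs)"
  using tensor_graph.step[OF tensor_graph.zero assms, of 1]
  by (intro fock_conj_eq) (simp add: scaleC_one)

lemma algebraic_tensors_fock_conj: "fock_conj ` algebraic_tensors = algebraic_tensors"
proof -
  have "fock_conj ` tens ` lists (range P1) = tens ` map J ` lists (range P1)"
    unfolding image_image by (intro image_cong) (simp_all add: fock_conj_tens)
  moreover have "map J ` lists (range P1) = lists (range P1)"
    using map_J_in_lists map_J_map_J by (metis image_eqI image_subsetI subsetI subset_antisym)
  ultimately show ?thesis
    unfolding algebraic_tensors_def Fock.cspan_J_image[symmetric] by simp
qed

lemma creation_fock_conj:
  assumes "f \<in> range P1"
  shows "fock_conj (creation f \<psi>) = creation (J f) (fock_conj \<psi>)"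
  unfolding creation_def
proof (rule Fock.lin_ext_on_conj[of "map J"])
  show "fock_conj (tens (f # fs)) = tens (J f # map J fs)" if "fs \<in> lists (range P1)" for fs
    using fock_conj_tens[of "f # fs"] assms that by simp
qed (simp_all only: map_J_map_J map_J_in_lists fock_conj_tens)

lemma annihilation_fock_conj: "fock_conj (annihilation f \<psi>) = annihilation (J f) (fock_conj \<psi>)"
  unfolding annihilation_def
proof (rule Fock.lin_ext_on_conj[of "map J"])
  fix fs assume fs: "fs \<in> lists (range P1)"
  have "fock_conj (tens (take i fs @ drop (Suc i) fs)) = tens (take i (map J fs) @ drop (Suc i) (map J fs))" for i
  proof -
    have "take i fs @ drop (Suc i) fs \<in> lists (range P1)"
      using fs set_take_subset[of i fs] set_drop_subset[of "Suc i" fs] by (auto simp: in_lists_conv_set)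
    then show ?thesis by (simp add: fock_conj_tens take_map drop_map)
  qed
  then show "fock_conj (\<Sum>i<length fs. cinner f (fs ! i) *\<^sub>C tens (take i fs @ drop (Suc i) fs))
    = (\<Sum>i<length (map J fs). cinner (J f) (map J fs ! i) *\<^sub>C
        tens (take i (map J fs) @ drop (Suc i) (map J fs)))"
    by (simp add: Fock.J_sum Fock.J_scaleC J_cinner)
qed (simp_all only: map_J_map_J map_J_in_lists fock_conj_tens)

lemma field_op_fock_conj: "fock_conj (field_op f \<psi>) = field_op (J f) (fock_conj \<psi>)"
  by (simp add: field_op_def Fock.J_add creation_fock_conj annihilation_fock_conj P1_J star_J)

text \<open>The inner products of \<open>tens\<close> determine the norm of the sum of both sides, which is zero.\<close>

lemma tens_uminus:
  assumes f: "f \<in> range P1" and fs: "fs \<in> lists (range P1)"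
  shows "tens (- f # fs) = - tens (f # fs)"
proof -
  from f obtain g where "f = P1 g" by blast
  then have "- f = P1 (- g)" by (simp add: P1_minus)
  then have f': "- f \<in> range P1" by blast
  have neg: "cinner (tens (- f # fs)) (tens hs) = - cinner (tens (f # fs)) (tens hs)"
    if "hs \<in> lists (range P1)" for hs
  proof -
    have "(\<Prod>i<Suc (length fs). cinner ((- f # fs) ! i) (hs ! \<sigma> i))
        = - (\<Prod>i<Suc (length fs). cinner ((f # fs) ! i) (hs ! \<sigma> i))" for \<sigma>
      by (simp only: prod.lessThan_Suc_shift nth_Cons_0 nth_Cons_Suc cinner_minus_left
          mult_minus_left)
    moreover have "- f # fs \<in> lists (range P1)" "f # fs \<in> lists (range P1)" using f f' fs by auto
    ultimately show ?thesis
      by (simp only: cinner_tens that length_Cons sum_negf split: if_split) simp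
  qed
  have neg': "cinner (tens hs) (tens (- f # fs)) = - cinner (tens hs) (tens (f # fs))"
    if "hs \<in> lists (range P1)" for hs
    using neg[OF that] by (simp add: cinner_commute[of "tens hs"])
  have "cinner (tens (- f # fs) + tens (f # fs)) (tens (- f # fs) + tens (f # fs)) = 0"
    using f f' fs by (simp add: cinner_add_left cinner_add_right neg neg')
  then show ?thesis
    unfolding cinner_self_eq_0 by (rule eq_neg_iff_add_eq_0[THEN iffD2])
qed

lemma field_op_uminus: "field_op (- f) \<psi> = - field_op f \<psi>"
proof -
  have "creation (- P1 f) \<psi> = - creation (P1 f) \<psi>"
    unfolding creation_def by (rule lin_ext_on_uminus) (simp add: tens_uminus)
  moreover have "annihilation (- g) \<psi> = - annihilation g \<psi>" for g
    unfolding annihilation_def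
    by (rule lin_ext_on_uminus)
      (simp add: cinner_minus_left sum_negf[symmetric] complex_vector.scale_minus_left)
  ultimately show ?thesis
    by (simp add: field_op_def P1_minus star_minus)
qed

text \<open>Antilinearity turns \<open>\<i> \<pi>(f)\<close> into \<open>- \<i> \<pi>(J f)\<close>, whence the sign.\<close>

lemma weyl_fock_conj: "conj_op fock_conj (weyl f) = weyl (- J f)"
proof -
  let ?\<Theta> = "map_prod fock_conj fock_conj"
  let ?graph = "\<lambda>f. (\<lambda>\<psi>. (\<psi>, \<i> *\<^sub>C field_op f \<psi>)) ` algebraic_tensors"
  have "fock_conj (\<i> *\<^sub>C field_op f \<psi>) = \<i> *\<^sub>C field_op (- J f) (fock_conj \<psi>)" for \<psi>
    by (simp add: Fock.J_scaleC field_op_fock_conj field_op_uminus complex_vector.scale_minus_left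
        complex_vector.scale_minus_right)
  then have "?\<Theta> ` ?graph f = (\<lambda>\<psi>. (\<psi>, \<i> *\<^sub>C field_op (- J f) \<psi>)) ` fock_conj ` algebraic_tensors"
    by (simp add: image_image)
  then have graph: "?\<Theta> ` ?graph f = ?graph (- J f)"
    by (simp add: algebraic_tensors_fock_conj)
  have "closure (?\<Theta> ` S) = ?\<Theta> ` closure S" for S
  proof (rule involution_image_commute)
    have "continuous_on T ?\<Theta>" for T
      unfolding map_prod_def case_prod_unfold
      by (intro continuous_on_Pair bounded_linear.continuous_on[OF Fock.J_bounded_linear]
          continuous_on_fst continuous_on_snd continuous_on_id)
    then show "?\<Theta> ` closure S \<subseteq> closure (?\<Theta> ` S)" for S
      by (rule image_closure_subset[OF _ closed_closure closure_subset])
    show "?\<Theta> (?\<Theta> p) = p" for p by (cases p) (simp add: Fock.J_J)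
  qed
  with graph show ?thesis
    unfolding weyl_def Fock.op_exp_conj_op[symmetric] by metis
qed

lemma weyl_algebra_fock_conj: "conj_op fock_conj ` weyl_algebra = weyl_algebra"
proof -
  let ?real = "{f. star f = f}"
  have "(\<lambda>f. - J f) ` ?real = ?real"
  proof
    show "(\<lambda>f. - J f) ` ?real \<subseteq> ?real" by (auto simp: star_minus star_J)
    show "?real \<subseteq> (\<lambda>f. - J f) ` ?real"
    proof
      fix f assume "f \<in> ?real"
      then show "f \<in> (\<lambda>f. - J f) ` ?real"
        by (intro image_eqI[of _ _ "- J f"]) (simp_all add: J_minus J_J star_minus star_J)
    qed
  qed
  moreover have "conj_op fock_conj ` weyl ` ?real = weyl ` (\<lambda>f. - J f) ` ?real"
    by (simp add: image_image weyl_fock_conj)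
  ultimately show ?thesis
    unfolding weyl_algebra_def Fock.cstar_generated_conj_op[symmetric] by (simp only:)
qed

text \<open>Two applications of \<open>weyl_fock_conj\<close> turn \<open>weyl f\<close> into \<open>weyl (J (V (J f)))\<close>; the two signs
  cancel by linearity of \<open>V\<close>.\<close>

lemma bogoliubov_endo_conj_op:
  assumes V: "clinear V"
  shows "bogoliubov_endo (conj_op J V)
    = (\<lambda>a. conj_op fock_conj (bogoliubov_endo V (conj_op fock_conj a)))"
proof -
  let ?c = "conj_op fock_conj"
  let ?endo = "\<lambda>V \<rho>. star_endomorphism weyl_algebra \<rho> \<and>
    (\<forall>f. star f = f \<longrightarrow> \<rho> (weyl f) = weyl (V f)) \<and>
    (\<forall>a. a \<notin> weyl_algebra \<longrightarrow> \<rho> a = (\<lambda>_. 0))"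
  have step: "?endo (conj_op J V) (\<lambda>a. ?c (\<rho> (?c a)))" if V: "clinear V" and \<rho>: "?endo V \<rho>" for V \<rho>
  proof (intro conjI allI impI)
    show "star_endomorphism weyl_algebra (\<lambda>a. ?c (\<rho> (?c a)))"
      using Fock.star_endomorphism_conj_op[of weyl_algebra \<rho>] \<rho>
      by (simp add: weyl_algebra_fock_conj)
    have V_minus: "V (- g) = - V g" for g
      using V unfolding clinear_iff by (metis scaleC_minus_one)
    show "?c (\<rho> (?c (weyl f))) = weyl (conj_op J V f)" if "star f = f" for f
    proof -
      have "\<rho> (weyl (- J f)) = weyl (V (- J f))"
        using \<rho> that by (simp add: star_minus star_J)
      then show ?thesis
        by (simp add: weyl_fock_conj V_minus J_minus conj_op_def[of J])
    qed
    show "?c (\<rho> (?c a)) = (\<lambda>_. 0)" if "a \<notin> weyl_algebra" for a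
    proof -
      have "?c a \<notin> weyl_algebra"
        using that weyl_algebra_fock_conj Fock.conj_op_image_iff by metis
      then show ?thesis using \<rho> by (simp add: Fock.conj_op_zero)
    qed
  qed
  have "clinear (conj_op J V)"
    using V unfolding clinear_iff conj_op_def by (simp add: J_add J_scaleC)
  from step[OF this] have "?endo V (\<lambda>a. ?c (\<rho> (?c a)))" if "?endo (conj_op J V) \<rho>" for \<rho>
    using that unfolding conj_op_conj_op by blast
  moreover note step[OF V]
  ultimately show ?thesis
    unfolding bogoliubov_endo_def
    by (intro the_or_involution[where \<phi> = "\<lambda>\<rho> a. ?c (\<rho> (?c a))"])
      (simp_all only: Fock.conj_op_conj_op Fock.conj_op_zero)
qed

lemma second_quantization_fock_conj:
  assumes U: "conj_op J U = U"
  shows "conj_op fock_conj (second_quantization U) = second_quantization U"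
proof -
  let ?G = "\<lambda>T. bounded_clinear T \<and>
    (\<forall>fs\<in>lists (range P1). T (tens fs) = tens (map (\<lambda>f. P1 (U f)) fs))"
  have "?G (conj_op fock_conj T)" if T: "?G T" for T
  proof (intro conjI ballI)
    show "bounded_clinear (conj_op fock_conj T)"
      using T by (simp add: Fock.bounded_clinear_conj_op)
    fix fs assume fs: "fs \<in> lists (range P1)"
    have "fock_conj (T (fock_conj (tens fs))) = fock_conj (tens (map (\<lambda>f. P1 (U (J f))) fs))"
      using T map_J_in_lists[OF fs] by (simp add: fock_conj_tens fs comp_def)
    also have "\<dots> = tens (map (\<lambda>f. J (P1 (U (J f)))) fs)"
      by (subst fock_conj_tens) (auto simp: comp_def)
    also have "(\<lambda>f. J (P1 (U (J f)))) = (\<lambda>f. P1 (U f))"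
      using U unfolding fun_eq_iff conj_op_def by (simp add: P1_J[symmetric])
    finally show "conj_op fock_conj T (tens fs) = tens (map (\<lambda>f. P1 (U f)) fs)"
      by (simp add: conj_op_def)
  qed
  then show ?thesis
    unfolding second_quantization_def
    by (intro the_or_involution[symmetric]) (simp_all add: Fock.conj_op_conj_op Fock.conj_op_zero)
qed

lemma implementers_inner_product_conj_op:
  "ip (implementers \<rho>) (conj_op fock_conj \<Psi>) (conj_op fock_conj \<Phi>)
    = cnj (ip (implementers \<rho>') \<Psi> \<Phi>)"
proof -
  let ?c = "conj_op fock_conj"
  have step: "\<forall>x. adj (?c \<Psi>) (?c \<Phi> x) = cnj a *\<^sub>C x" if "\<forall>x. adj \<Psi> (\<Phi> x) = a *\<^sub>C x" for \<Psi> \<Phi> a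
    using that by (simp add: Fock.adj_conj_op conj_op_def Fock.J_J Fock.J_scaleC)
  have converse: "\<forall>x. adj \<Psi> (\<Phi> x) = cnj a *\<^sub>C x" if "\<forall>x. adj (?c \<Psi>) (?c \<Phi> x) = a *\<^sub>C x" for a
    using step[OF that] by (simp add: Fock.conj_op_conj_op)
  show ?thesis
    unfolding implementers_def inner_space.simps
    by (intro the_or_involution[OF complex_cnj_cnj complex_cnj_zero]) (fact step converse)+
qed

text \<open>The equivalence is conjugation by \<open>fock_conj\<close>. It is antilinear and conjugates inner products,
  that is, it is unitary onto the conjugate space.\<close>

lemma gauge_rep_conj_op:
  assumes V: "clinear V" and G: "\<And>U. U \<in> G \<Longrightarrow> conj_op J U = U"
  shows "unitarily_equivalent G (gauge_rep (conj_op J V)) (complex_conjugate_rep (gauge_rep V))"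
proof -
  let ?c = "conj_op fock_conj"
  let ?\<rho> = "bogoliubov_endo V" and ?\<rho>' = "bogoliubov_endo (conj_op J V)"
  let ?H = "implementers ?\<rho>'" and ?H' = "conjugate_space (implementers ?\<rho>)"
  have \<rho>': "?\<rho>' w = ?c (?\<rho> (?c w))" for w
    using bogoliubov_endo_conj_op[OF V] by metis
  then have \<rho>: "?\<rho> w = ?c (?\<rho>' (?c w))" for w by (simp add: Fock.conj_op_conj_op)
  have c_W: "?c w \<in> weyl_algebra" if "w \<in> weyl_algebra" for w
    using that weyl_algebra_fock_conj by blast
  have carr: "?c \<Psi> \<in> carr (implementers \<sigma>)"
    if \<Psi>: "\<Psi> \<in> carr (implementers \<tau>)" and \<sigma>: "\<And>w. \<sigma> w = ?c (\<tau> (?c w))" for \<Psi> \<sigma> \<tau>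
  proof -
    have "?c \<Psi> \<circ> w = \<sigma> w \<circ> ?c \<Psi>" if w: "w \<in> weyl_algebra" for w
    proof -
      have "\<Psi> \<circ> ?c w = \<tau> (?c w) \<circ> \<Psi>"
        using \<Psi> c_W[OF w] by (simp add: implementers_def)
      then have "?c (\<Psi> \<circ> ?c w) = ?c (\<tau> (?c w) \<circ> \<Psi>)" by (rule arg_cong)
      then show ?thesis by (simp add: Fock.conj_op_comp Fock.conj_op_conj_op \<sigma>)
    qed
    then show ?thesis
      using \<Psi> by (simp add: implementers_def Fock.bounded_clinear_conj_op)
  qed
  have "bij_betw ?c (carr ?H) (carr ?H')"
    by (rule bij_betwI[of _ _ _ ?c])
      (auto simp: conjugate_space_def Fock.conj_op_conj_op intro: carr[where \<sigma> = ?\<rho> and \<tau> = ?\<rho>', OF _ \<rho>]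
          carr[where \<sigma> = ?\<rho>' and \<tau> = ?\<rho>, OF _ \<rho>'])
  moreover have "?c (add ?H \<Psi> \<Phi>) = add ?H' (?c \<Psi>) (?c \<Phi>)" for \<Psi> \<Phi>
    by (simp add: implementers_def conjugate_space_def Fock.conj_op_add)
  moreover have "?c (scale ?H a \<Psi>) = scale ?H' a (?c \<Psi>)" for a \<Psi>
    by (simp add: implementers_def conjugate_space_def Fock.conj_op_scaleC)
  moreover have "ip ?H' (?c \<Psi>) (?c \<Phi>) = ip ?H \<Psi> \<Phi>" for \<Psi> \<Phi>
    using implementers_inner_product_conj_op[of ?\<rho> \<Psi> \<Phi> ?\<rho>'] by (simp add: conjugate_space_def)
  moreover have "?c (second_quantization U \<circ> \<Psi> \<circ> adj (second_quantization U))
      = second_quantization U \<circ> ?c \<Psi> \<circ> adj (second_quantization U)" if "U \<in> G" for U \<Psi>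
    using second_quantization_fock_conj[OF G[OF that]]
    by (simp add: Fock.conj_op_comp Fock.adj_conj_op[symmetric])
  ultimately show ?thesis
    unfolding unitarily_equivalent_def gauge_rep_def complex_conjugate_rep_def
      Let_def prod.case fst_conv snd_conv
    by (intro exI[of _ ?c]) simp
qed

end


section \<open>The charge conjugation\<close>

lemma the_or_property: "the_or d P \<noteq> d \<Longrightarrow> P (the_or d P)"
  using theI'[of P] by (simp add: the_or_def split: if_splits)

text \<open>The equation \<open>adj Q = Q\<close> alone could hold at a vector by virtue of the default value. If
  \<open>Q x \<noteq> 0\<close> then \<open>adj Q x\<close> is not the default value, so it has the defining property of the
  adjoint. If \<open>Q x = 0\<close>, this property at the vector \<open>Q y = Q (Q y)\<close> shows that \<open>x\<close> is
  orthogonal to \<open>Q y\<close>.\<close>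

lemma orth_projection_cinner:
  assumes "orth_projection Q"
  shows "cinner (Q x) y = cinner x (Q y)"
proof -
  have adj: "adj Q = Q" and QQ: "Q (Q x) = Q x" for x
    using assms by (auto simp: orth_projection_def self_adjoint_def fun_eq_iff)
  have *: "cinner (Q x) z = cinner x (Q z)" if "Q x \<noteq> 0" for x z
  proof -
    let ?p = "\<lambda>u. u \<in> UNIV \<and> (\<forall>z\<in>UNIV. cinner u z = cinner x (Q z))"
    have "Q x = the_or 0 ?p" using fun_cong[OF adj, of x] by (simp add: adj_on_def)
    then show ?thesis using the_or_property[of 0 ?p] that by simp
  qed
  show ?thesis
  proof (cases "Q x = 0")
    case True
    have "cinner (Q y) x = 0"
    proof (cases "Q y = 0")
      case False
      then have "cinner (Q (Q y)) x = cinner (Q y) (Q x)" by (intro *) (simp add: QQ)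
      then show ?thesis using True cinner_diff_right[of "Q y" 0 0] by (simp add: QQ)
    qed (simp add: cinner_zero_left)
    then show ?thesis
      using True cinner_commute[of x "Q y"] by (simp add: cinner_zero_left)
  qed (rule *)
qed

text \<open>Testing the defining property of the adjoint against \<open>u\<close> and \<open>x\<close> themselves gives
  \<open>norm (u - x) = 0\<close> for any solution \<open>u\<close>.\<close>

lemma adj_on_unitary:
  assumes T: "unitary_between H H' T" and x: "x \<in> H"
  shows "adj_on H T (T x) = x"
  unfolding adj_on_def
proof (rule the_or_equality)
  show "x \<in> H \<and> (\<forall>z\<in>H. cinner x z = cinner (T x) (T z))"
    using T x unfolding unitary_between_def by simp
  fix u assume u: "u \<in> H \<and> (\<forall>z\<in>H. cinner u z = cinner (T x) (T z))"
  then have "cinner u z = cinner x z" if "z \<in> H" for z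
    using T x that unfolding unitary_between_def by simp
  then have "cinner (u - x) (u - x) = 0"
    using u x by (simp add: cinner_diff_left cinner_diff_right)
  then show "u = x" by (simp add: cinner_self_eq_0)
qed

lemma self_adjoint_if_symmetric:
  assumes "bounded_clinear T" "\<And>x y. cinner (T x) y = cinner x (T y)"
  shows "self_adjoint T"
proof -
  have "adj T y = T y" for y
    unfolding adj_on_def
    by (rule the_or_equality) (use assms(2) in \<open>auto intro: cinner_eqI\<close>)
  with assms(1) show ?thesis by (simp add: self_adjoint_def fun_eq_iff)
qed

locale charge_conjugation_data = ccr_space \<kappa> star P1
  for \<kappa> :: "'k::chilbert_space \<Rightarrow> 'k \<Rightarrow> complex" and star P1 +
  fixes P Cpm :: "'k \<Rightarrow> 'k"
  assumes P_proj: "orth_projection P"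
    and P_conj: "P f + conj_op star P f = f"
    and P_P1_comp: "P \<circ> P1 = P1 \<circ> P"
    and Cpm_unitary: "unitary_between (range (P \<circ> P2)) (range (P \<circ> P1)) Cpm"
begin

lemma P_add: "P (f + g) = P f + P g"
  and P_scaleC: "P (c *\<^sub>C f) = c *\<^sub>C P f"
  and P_P: "P (P f) = P f"
  using P_proj unfolding orth_projection_def self_adjoint_def bounded_clinear_def clinear_iff
  by (auto simp: fun_eq_iff)

lemma P_diff: "P (f - g) = P f - P g"
  using P_add[of "f - g" g] by (simp add: algebra_simps)

lemma P_P1: "P (P1 f) = P1 (P f)"
  using P_P1_comp by (simp add: fun_eq_iff)

lemma P_P2: "P (P2 f) = P2 (P f)"
  by (simp add: P2_def P_diff P_P1)

lemma P_zero: "P 0 = 0"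
  using P_diff[of 0 0] by simp

lemma P1_P2: "P1 (P2 f) = 0"
  by (simp add: P2_def P1_diff P1_P1)

lemma P_star: "P (star f) = star (f - P f)"
proof -
  have "star (P (star f)) = f - P f"
    using P_conj[of f] by (simp add: conj_op_def algebra_simps)
  then show ?thesis by (metis star_star)
qed

text \<open>\<open>K_plus\<close> and \<open>K_minus\<close> are the subspaces \<open>\<K>\<^sub>+\<close> and \<open>\<K>\<^sub>-\<close> of \<open>range P\<close>, and \<open>Cmp\<close> is the
  lower left matrix entry, which inverts \<open>Cpm\<close>.\<close>

definition K_plus :: "'k set" where "K_plus = range (P \<circ> P1)"
definition K_minus :: "'k set" where "K_minus = range (P \<circ> P2)"

lemma K_plus_iff: "f \<in> K_plus \<longleftrightarrow> P f = f \<and> P1 f = f"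
proof
  assume "P f = f \<and> P1 f = f"
  then have "f = (P \<circ> P1) f" by simp
  then show "f \<in> K_plus" unfolding K_plus_def by blast
qed (auto simp: K_plus_def P_P P_P1 P1_P1)

lemma K_minus_iff: "f \<in> K_minus \<longleftrightarrow> P f = f \<and> P1 f = 0"
proof
  assume "f \<in> K_minus"
  then obtain g where "f = P (P2 g)" unfolding K_minus_def by auto
  then show "P f = f \<and> P1 f = 0"
    by (simp add: P_P P_P1[symmetric] P1_P2 P_zero)
next
  assume "P f = f \<and> P1 f = 0"
  then have "f = (P \<circ> P2) f" by (simp add: P2_def)
  then show "f \<in> K_minus" unfolding K_minus_def by blast
qed

lemma K_plus_P: "P (P1 f) \<in> K_plus"
  and K_minus_P: "P (P2 f) \<in> K_minus"
  unfolding K_plus_def K_minus_def by auto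

lemma cinner_K_plus: "f \<in> K_plus \<Longrightarrow> cinner f (P (P1 g)) = cinner f g"
  using orth_projection_cinner[OF P_proj, of f "P1 g"] cinner_P1[of f g] by (simp add: K_plus_iff)

lemma cinner_K_minus: "f \<in> K_minus \<Longrightarrow> cinner f (P (P2 g)) = cinner f g"
  using orth_projection_cinner[OF P_proj, of f "P2 g"] cinner_P1[of f g]
  by (simp add: K_minus_iff P2_def cinner_diff_right cinner_zero_left)

lemma Cpm_K_plus: "f \<in> K_minus \<Longrightarrow> Cpm f \<in> K_plus"
  and Cpm_add: "f \<in> K_minus \<Longrightarrow> g \<in> K_minus \<Longrightarrow> Cpm (f + g) = Cpm f + Cpm g"
  and Cpm_scaleC: "f \<in> K_minus \<Longrightarrow> Cpm (c *\<^sub>C f) = c *\<^sub>C Cpm f"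
  and Cpm_cinner: "f \<in> K_minus \<Longrightarrow> g \<in> K_minus \<Longrightarrow> cinner (Cpm f) (Cpm g) = cinner f g"
  and Cpm_surj: "g \<in> K_plus \<Longrightarrow> \<exists>f\<in>K_minus. g = Cpm f"
  using Cpm_unitary unfolding unitary_between_def K_plus_def[symmetric] K_minus_def[symmetric]
  by (auto simp: bij_betw_def)

definition Cmp :: "'k \<Rightarrow> 'k" where "Cmp = adj_on K_minus Cpm"

lemma Cmp_Cpm: "f \<in> K_minus \<Longrightarrow> Cmp (Cpm f) = f"
  unfolding Cmp_def K_minus_def by (rule adj_on_unitary[OF Cpm_unitary])

lemma Cpm_Cmp: "g \<in> K_plus \<Longrightarrow> Cpm (Cmp g) = g"
  and Cmp_K_minus: "g \<in> K_plus \<Longrightarrow> Cmp g \<in> K_minus"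
  using Cpm_surj Cmp_Cpm by fastforce+

lemma Cmp_eqI: "f \<in> K_minus \<Longrightarrow> Cpm f = g \<Longrightarrow> Cmp g = f"
  using Cmp_Cpm by blast

lemma Cmp_add:
  assumes "f \<in> K_plus" "g \<in> K_plus"
  shows "Cmp (f + g) = Cmp f + Cmp g"
proof (rule Cmp_eqI)
  show "Cmp f + Cmp g \<in> K_minus"
    using Cmp_K_minus[OF assms(1)] Cmp_K_minus[OF assms(2)]
    by (simp add: K_minus_iff P_add P1_add)
qed (simp add: assms Cpm_add Cmp_K_minus Cpm_Cmp)

lemma Cmp_scaleC:
  assumes "f \<in> K_plus"
  shows "Cmp (c *\<^sub>C f) = c *\<^sub>C Cmp f"
proof (rule Cmp_eqI)
  show "c *\<^sub>C Cmp f \<in> K_minus"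
    using Cmp_K_minus[OF assms] by (simp add: K_minus_iff P_scaleC P1_scaleC)
qed (simp add: assms Cpm_scaleC Cmp_K_minus Cpm_Cmp)

text \<open>The corner \<open>P Cc P\<close> of the charge conjugation, that is, its prescribed matrix: a symmetric
  operator whose square is \<open>P\<close>.\<close>

definition corner :: "'k \<Rightarrow> 'k"
  where "corner f = Cpm (P (P2 f)) + Cmp (P (P1 f))"

lemma corner_add: "corner (f + g) = corner f + corner g"
proof -
  have "P2 (f + g) = P2 f + P2 g" by (simp add: P2_def P1_add)
  then show ?thesis
    by (simp add: corner_def P1_add P_add Cpm_add Cmp_add K_minus_P K_plus_P)
qed

lemma corner_scaleC: "corner (c *\<^sub>C f) = c *\<^sub>C corner f"
proof -
  have "P2 (c *\<^sub>C f) = c *\<^sub>C P2 f"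
    by (simp add: P2_def P1_scaleC complex_vector.scale_right_diff_distrib)
  then show ?thesis
    by (simp add: corner_def P1_scaleC P_scaleC Cpm_scaleC Cmp_scaleC K_minus_P K_plus_P
        scaleC_add_right)
qed

lemma corner_zero: "corner 0 = 0"
  using corner_add[of 0 0] by simp

lemma P_corner: "P (corner f) = corner f"
  using Cpm_K_plus[OF K_minus_P[of f]] Cmp_K_minus[OF K_plus_P[of f]]
  by (simp add: corner_def P_add K_plus_iff K_minus_iff)

lemma P1_corner: "P1 (corner f) = Cpm (P (P2 f))"
  using Cpm_K_plus[OF K_minus_P[of f]] Cmp_K_minus[OF K_plus_P[of f]]
  by (simp add: corner_def P1_add K_plus_iff K_minus_iff)

lemma P2_corner: "P2 (corner f) = Cmp (P (P1 f))"
  unfolding P2_def[of "corner f"] P1_corner by (simp add: corner_def)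

lemma corner_P: "corner (P f) = corner f"
  by (simp add: corner_def P_P P_P1[symmetric] P_P2[symmetric])

lemma corner_corner: "corner (corner f) = P f"
proof -
  have "corner (corner f) = Cpm (P (Cmp (P (P1 f)))) + Cmp (P (Cpm (P (P2 f))))"
    unfolding corner_def[of "corner f"] P1_corner P2_corner ..
  also have "P (Cmp (P (P1 f))) = Cmp (P (P1 f))"
    using Cmp_K_minus[OF K_plus_P[of f]] by (simp add: K_minus_iff)
  also have "P (Cpm (P (P2 f))) = Cpm (P (P2 f))"
    using Cpm_K_plus[OF K_minus_P[of f]] by (simp add: K_plus_iff)
  also have "Cpm (Cmp (P (P1 f))) + Cmp (Cpm (P (P2 f))) = P (P1 f) + P (P2 f)"
    by (simp add: Cpm_Cmp Cmp_Cpm K_plus_P K_minus_P)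
  finally show ?thesis by (simp add: P_add[symmetric] P2_def)
qed

lemma P1_corner_commute: "P1 (corner f) = corner (P2 f)"
proof -
  have "P1 (P2 f) = 0" "P2 (P2 f) = P2 f" by (simp_all add: P2_def P1_diff P1_P1)
  moreover have "Cmp (P 0) = 0"
    using Cmp_scaleC[OF K_plus_P[of 0], of 0] P_scaleC[of 0 0] P1_scaleC[of 0 0] by simp
  ultimately show ?thesis unfolding P1_corner corner_def[of "P2 f"] by simp
qed

lemma P2_corner_commute: "P2 (corner f) = corner (P1 f)"
proof -
  have "f = P1 f + P2 f" by (simp add: P2_def)
  then have "corner f = corner (P1 f) + corner (P2 f)" by (metis corner_add)
  then show ?thesis unfolding P2_def[of "corner f"] P1_corner_commute by simp
qed

lemma corner_symmetric: "cinner (corner f) g = cinner f (corner g)"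
proof -
  let ?f1 = "P (P1 f)" and ?f2 = "P (P2 f)" and ?g1 = "P (P1 g)" and ?g2 = "P (P2 g)"
  have flip: "cinner x (Cmp y) = cinner (Cpm x) y" if "x \<in> K_minus" "y \<in> K_plus" for x y
    using Cpm_cinner[OF that(1) Cmp_K_minus[OF that(2)]] that by (simp add: Cpm_Cmp)
  have flip': "cinner (Cmp y) x = cinner y (Cpm x)" if "x \<in> K_minus" "y \<in> K_plus" for x y
    using flip[OF that] by (metis cinner_commute)
  have "cinner (corner f) g = cinner (Cpm ?f2) ?g1 + cinner (Cmp ?f1) ?g2"
    by (simp add: corner_def cinner_add_left cinner_K_plus cinner_K_minus Cpm_K_plus
        Cmp_K_minus K_plus_P K_minus_P)
  also have "\<dots> = cinner ?f2 (Cmp ?g1) + cinner ?f1 (Cpm ?g2)"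
    by (simp add: flip flip' K_plus_P K_minus_P)
  also have "cinner ?f2 (Cmp ?g1) = cinner f (Cmp ?g1)"
    using cinner_K_minus[OF Cmp_K_minus[OF K_plus_P[of g]], of f] by (metis cinner_commute)
  also have "cinner ?f1 (Cpm ?g2) = cinner f (Cpm ?g2)"
    using cinner_K_plus[OF Cpm_K_plus[OF K_minus_P[of g]], of f] by (metis cinner_commute)
  finally show ?thesis by (simp add: corner_def cinner_add_right)
qed

text \<open>\<open>star\<close> maps \<open>range P\<close> onto its orthogonal complement, where \<open>corner\<close> vanishes. Hence the mixed
  terms in the square of \<open>charge_conj\<close> disappear.\<close>

lemma corner_star_corner: "corner (star (corner f)) = 0"
proof -
  have "P (star (corner f)) = star 0" by (simp add: P_star P_corner)
  also have "star 0 = 0" using star_diff[of 0 0] by simp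
  finally show ?thesis by (metis corner_P corner_zero)
qed

text \<open>Reality and commutation with \<open>P\<close> force the other corner of the charge conjugation to be the
  \<open>star\<close>-conjugate of the prescribed one.\<close>

definition charge_conj :: "'k \<Rightarrow> 'k"
  where "charge_conj f = corner f + star (corner (star f))"

lemma charge_conj_add: "charge_conj (f + g) = charge_conj f + charge_conj g"
  by (simp add: charge_conj_def corner_add star_add)

lemma charge_conj_scaleC: "charge_conj (c *\<^sub>C f) = c *\<^sub>C charge_conj f"
  by (simp add: charge_conj_def corner_scaleC star_scaleC scaleC_add_right)

lemma charge_conj_star: "charge_conj (star f) = star (charge_conj f)"
  by (simp add: charge_conj_def star_add star_star add.commute)

lemma charge_conj_charge_conj: "charge_conj (charge_conj f) = f"
proof -
  have zero: "star 0 = 0" using star_diff[of 0 0] by simp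
  have "charge_conj (charge_conj f) = P f + star (P (star f))"
    by (simp add: charge_conj_def corner_add star_add star_star corner_corner corner_star_corner zero)
  also have "\<dots> = f" by (simp add: P_star star_star)
  finally show ?thesis .
qed

lemma charge_conj_symmetric: "cinner (charge_conj f) g = cinner f (charge_conj g)"
proof -
  interpret star: conjugation star by (rule star_conjugation)
  show ?thesis
    using star.cinner_J_left[of "corner (star f)" g] star.cinner_J_right[of f "corner (star g)"]
    by (simp add: charge_conj_def cinner_add_left cinner_add_right corner_symmetric)
qed

lemma P1_charge_conj: "P1 (charge_conj f) = charge_conj (P2 f)"
  by (simp add: charge_conj_def P1_add P1_corner_commute P1_star P2_corner_commute P2_star)

lemma charge_conj_diff: "charge_conj (f - g) = charge_conj f - charge_conj g"
  using charge_conj_add[of "f - g" g] by (simp add: algebra_simps)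

lemma P2_charge_conj: "P2 (charge_conj f) = charge_conj (P1 f)"
  unfolding P2_def[of "charge_conj f"] P1_charge_conj P2_def charge_conj_diff by simp

lemma C_charge_conj: "C (charge_conj f) = - charge_conj (C f)"
  by (simp add: C_def P1_charge_conj P2_charge_conj charge_conj_diff)

lemma charge_conj_norm: "norm (charge_conj f) = norm f"
  by (rule norm_eq_if_cinner_self_eq) (simp add: charge_conj_symmetric charge_conj_charge_conj)

lemma charge_conj_unitary: "unitary charge_conj"
proof -
  have "bij charge_conj" using charge_conj_charge_conj by (metis bijI')
  then show ?thesis
    unfolding unitary_between_def
    by (simp add: charge_conj_add charge_conj_scaleC charge_conj_symmetric charge_conj_charge_conj)
qed

lemma charge_conj_self_adjoint: "self_adjoint charge_conj"
proof (rule self_adjoint_if_symmetric)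
  have "bounded_linear charge_conj"
    by (rule bounded_linear_intro[where K = 1])
      (simp_all add: charge_conj_add charge_conj_scaleC scaleR_scaleC charge_conj_norm)
  then show "bounded_clinear charge_conj"
    by (simp add: bounded_clinear_def clinear_iff charge_conj_add charge_conj_scaleC)
qed (rule charge_conj_symmetric)

lemma dagger_charge_conj: "dagger charge_conj f = - charge_conj f"
proof -
  have "adj charge_conj = charge_conj" using charge_conj_self_adjoint by (simp add: self_adjoint_def)
  then show ?thesis by (simp add: dagger_def C_charge_conj C_C)
qed

lemma charge_conjugation_charge_conj: "charge_conjugation P Cpm charge_conj"
proof -
  have comm: "P (charge_conj f) = corner f" for f
    by (simp add: charge_conj_def P_add P_corner P_star)
      (metis P_corner add.right_neutral cancel_comm_monoid_add_class.diff_cancel star_diff)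
  have comm': "charge_conj (P f) = corner f" for f
  proof -
    have "corner (star (P f)) = corner (P (star (P f)))" by (simp add: corner_P)
    also have "P (star (P f)) = star 0" by (simp add: P_star P_P)
    also have "star 0 = 0" using star_diff[of 0 0] by simp
    finally have "corner (star (P f)) = 0" by (simp add: corner_zero)
    moreover have "star 0 = 0" using star_diff[of 0 0] by simp
    ultimately show ?thesis by (simp add: charge_conj_def corner_P)
  qed
  show ?thesis
    unfolding charge_conjugation_def K_minus_def[symmetric] Cmp_def[symmetric]
    by (simp add: clinear_iff charge_conj_add charge_conj_scaleC fun_eq_iff comm comm' conj_op_def
        charge_conj_star star_star corner_P P_corner) (simp add: corner_def)
qed

lemma charge_conjugation_unique:
  assumes "charge_conjugation P Cpm Cc"
  shows "Cc = charge_conj"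
proof
  fix f
  from assms have add: "Cc (f + g) = Cc f + Cc g" and comm: "Cc (P f) = P (Cc f)"
    and real: "star (Cc (star f)) = Cc f" and corner: "P (Cc (P f)) = corner f" for f g
    unfolding charge_conjugation_def K_minus_def[symmetric] Cmp_def[symmetric]
    by (auto simp: clinear_iff fun_eq_iff conj_op_def corner_def)
  have Cc_P: "Cc (P f) = corner f" for f
    using comm[of "P f"] corner[of f] by (simp add: P_P)
  have "f = P f + star (P (star f))" by (simp add: P_star star_star)
  then have "Cc f = Cc (P f) + Cc (star (P (star f)))" by (metis add)
  also have "Cc (star (P (star f))) = star (Cc (P (star f)))"
    using real[of "star (P (star f))"] by (simp add: star_star)
  finally show "Cc f = charge_conj f" by (simp add: Cc_P charge_conj_def)
qed

lemma charge_conj_commute: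
  assumes add: "\<And>f g. U (f + g) = U f + U g" and P1: "\<And>f. U (P1 f) = P1 (U f)"
    and star: "\<And>f. U (star f) = star (U f)" and P: "\<And>f. U (P f) = P (U f)"
    and Cpm: "\<And>f. f \<in> K_minus \<Longrightarrow> Cpm (U f) = U (Cpm f)"
  shows "U (charge_conj f) = charge_conj (U f)"
proof -
  have diff: "U (f - g) = U f - U g" for f g
    using add[of "f - g" g] by (simp add: algebra_simps)
  have K_minus: "U f \<in> K_minus" if "f \<in> K_minus" for f
    using that P[of f] P1[of f] diff[of 0 0] by (simp add: K_minus_iff)
  have Cmp: "Cmp (U g) = U (Cmp g)" if "g \<in> K_plus" for g
    using that by (intro Cmp_eqI) (simp_all add: K_minus Cmp_K_minus Cpm Cpm_Cmp)
  have "U (P2 f) = P2 (U f)" for f by (simp add: P2_def diff P1)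
  then have "U (corner f) = corner (U f)" for f
    unfolding corner_def add
    using Cmp[OF K_plus_P[of f]] Cpm[OF K_minus_P[of f]] by (simp add: P P1)
  then show ?thesis by (simp add: charge_conj_def add star)
qed

text \<open>Both \<open>charge_conj\<close> and \<open>star\<close> exchange \<open>range P1\<close> and \<open>range P2\<close>.\<close>

lemma ccr_conjugation_charge_conj_star: "ccr_conjugation \<kappa> star P1 (charge_conj \<circ> star)"
proof -
  interpret star: conjugation star by (rule star_conjugation)
  show ?thesis
    by unfold_locales
      (simp_all add: charge_conj_add star_add charge_conj_scaleC star_scaleC charge_conj_star
        star_star charge_conj_charge_conj star.J_cinner charge_conj_symmetric P1_star P2_charge_conj)
qed

lemma conj_op_charge_conj_star:
  assumes "conj_op star A = A"
  shows "conj_op (charge_conj \<circ> star) A = charge_conj \<circ> A \<circ> charge_conj"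
  using assms by (simp add: fun_eq_iff conj_op_def charge_conj_star[symmetric])
     (simp add: charge_conj_star)

end

section \<open>Charge conjugate Bogoliubov operators\<close>

theorem proposition4p13:
  fixes \<kappa> :: "'k::chilbert_space \<Rightarrow> 'k \<Rightarrow> complex"
    and star P1 :: "'k \<Rightarrow> 'k"
    and tens :: "'k list \<Rightarrow> 'f::chilbert_space"
    and G :: "('k \<Rightarrow> 'k) set"
    and P Cpm :: "'k \<Rightarrow> 'k"
  assumes fock: "fock_space \<kappa> star P1 tens"
    and G: "ccr_space.gauge_group star P1 G"
    and P_proj: "orth_projection P"
    and P_conj: "\<forall>f. P f + conj_op star P f = f"
    and P_P1: "P \<circ> P1 = P1 \<circ> P"
    and P_G: "\<forall>U\<in>G. P \<circ> U = U \<circ> P"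
    and Cpm_unitary: "unitary_between (range (P \<circ> ccr_space.P2 P1)) (range (P \<circ> P1)) Cpm"
    and Cpm_G: "\<forall>U\<in>G. \<forall>f\<in>range (P \<circ> ccr_space.P2 P1). Cpm (U f) = U (Cpm f)"
  shows "(\<exists>!Cc. ccr_space.charge_conjugation star P1 P Cpm Cc) \<and>
    (\<forall>Cc. ccr_space.charge_conjugation star P1 P Cpm Cc \<longrightarrow>
      (\<forall>U\<in>G. Cc \<circ> U = U \<circ> Cc) \<and>
      unitary Cc \<and>
      self_adjoint Cc \<and>
      (\<forall>f. Cc (ccr_space.C P1 f) + ccr_space.C P1 (Cc f) = 0) \<and>
      (\<forall>f. ccr_space.dagger P1 Cc f = - Cc f) \<and>
      semigroup_automorphism (ccr_space.bogoliubov_P1_G star P1 G) (\<lambda>V. Cc \<circ> V \<circ> Cc) \<and>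
      (\<forall>V\<in>ccr_space.bogoliubov_P1_G star P1 G. Cc \<circ> (Cc \<circ> V \<circ> Cc) \<circ> Cc = V) \<and>
      (\<forall>V\<in>ccr_space.bogoliubov_P1_G star P1 G.
        ccr_space.frak_k P1 (Cc \<circ> V \<circ> Cc) = Cc ` star ` ccr_space.frak_k P1 V \<and>
        unitarily_equivalent G
          (fock_space.gauge_rep star P1 tens (Cc \<circ> V \<circ> Cc))
          (complex_conjugate_rep (fock_space.gauge_rep star P1 tens V))))"
proof -
  interpret fock_space \<kappa> star P1 tens by (rule fock)
  interpret charge_conjugation_data \<kappa> star P1 P Cpm
    by unfold_locales (use P_proj P_conj P_P1 Cpm_unitary in auto)
  interpret J: ccr_conjugation \<kappa> star P1 "charge_conj \<circ> star"
    by (rule ccr_conjugation_charge_conj_star)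
  interpret fock_conjugation \<kappa> star P1 tens "charge_conj \<circ> star" ..
  have U: "U \<in> bogoliubov" "U \<circ> P1 = P1 \<circ> U" if "U \<in> G" for U
    using G that unfolding gauge_group_def by auto
  have gauge: "charge_conj (U f) = U (charge_conj f)" if "U \<in> G" for U f
  proof (rule charge_conj_commute[symmetric])
    note * = U[OF that, unfolded bogoliubov_def bounded_clinear_def clinear_iff]
    show "U (f + g) = U f + U g" for f g using * by blast
    show "U (P1 f) = P1 (U f)" for f using * by (simp add: fun_eq_iff)
    show "U (star f) = star (U f)" for f using * by (simp add: fun_eq_iff conj_op_def) (metis star_star)
    show "U (P f) = P (U f)" for f using P_G that by (simp add: fun_eq_iff)
    show "Cpm (U f) = U (Cpm f)" if "f \<in> K_minus" for f
      using Cpm_G \<open>U \<in> G\<close> that unfolding K_minus_def by blast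
  qed
  have real: "conj_op star V = V" if "V \<in> bogoliubov" for V
    using that by (simp add: bogoliubov_def)
  have G_J: "conj_op (charge_conj \<circ> star) U = U" if "U \<in> G" for U
    unfolding conj_op_charge_conj_star[OF real[OF U(1)[OF that]]]
    by (simp add: fun_eq_iff gauge[OF that, symmetric] charge_conj_charge_conj)
  let ?S = "bogoliubov_P1_G G" and ?\<phi> = "\<lambda>V. charge_conj \<circ> V \<circ> charge_conj"
  have S: "V \<in> bogoliubov" if "V \<in> ?S" for V
    using that by (simp add: bogoliubov_P1_G_def bogoliubov_P1_def)
  have \<phi>: "?\<phi> V = conj_op (charge_conj \<circ> star) V" if "V \<in> ?S" for V
    by (rule conj_op_charge_conj_star[OF real[OF S[OF that]], symmetric])
  have \<phi>_S: "?\<phi> V \<in> ?S" if "V \<in> ?S" for V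
    unfolding \<phi>[OF that] using that G_J by (rule J.bogoliubov_P1_G_conj_op)
  have involution: "?\<phi> (?\<phi> V) = V" for V
    by (simp add: fun_eq_iff charge_conj_charge_conj)
  have "bij_betw ?\<phi> ?S ?S"
    by (rule bij_betwI[of _ _ _ ?\<phi>]) (auto simp: \<phi>_S involution)
  then have automorphism: "semigroup_automorphism ?S ?\<phi>"
    by (simp add: semigroup_automorphism_def fun_eq_iff charge_conj_charge_conj)
  have frak_k: "frak_k (?\<phi> V) = charge_conj ` star ` frak_k V" if "V \<in> ?S" for V
    unfolding \<phi>[OF that] J.frak_k_conj_op by (simp add: image_image)
  have rep: "unitarily_equivalent G (gauge_rep (?\<phi> V)) (complex_conjugate_rep (gauge_rep V))"
    if "V \<in> ?S" for V
    unfolding \<phi>[OF that]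
  proof (rule gauge_rep_conj_op)
    show "clinear V" using S[OF that] by (simp add: bogoliubov_def bounded_clinear_def)
  qed (rule G_J)
  have main: "(\<forall>U\<in>G. charge_conj \<circ> U = U \<circ> charge_conj) \<and> unitary charge_conj \<and>
      self_adjoint charge_conj \<and> (\<forall>f. charge_conj (C f) + C (charge_conj f) = 0) \<and>
      (\<forall>f. dagger charge_conj f = - charge_conj f) \<and> semigroup_automorphism ?S ?\<phi> \<and>
      (\<forall>V\<in>?S. ?\<phi> (?\<phi> V) = V) \<and>
      (\<forall>V\<in>?S. frak_k (?\<phi> V) = charge_conj ` star ` frak_k V \<and>
        unitarily_equivalent G (gauge_rep (?\<phi> V)) (complex_conjugate_rep (gauge_rep V)))"
    using gauge charge_conj_unitary charge_conj_self_adjoint automorphism frak_k rep involution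
    by (simp add: C_charge_conj dagger_charge_conj fun_eq_iff)
  have "charge_conjugation P Cpm Cc \<longleftrightarrow> Cc = charge_conj" for Cc
    using charge_conjugation_charge_conj charge_conjugation_unique by blast
  then show ?thesis
    by (simp only:) (rule conjI, blast, intro allI impI, hypsubst, rule main)
qed

end
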